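(* Let $(S,+,\cdot)$ be a semiring and let $(R,\cdot)$ be a left amenable subsemigroup of $(S,\cdot)$ such that $R$ is combinatorially rich in $(S,+)$. If $A \subseteq R$ has positive upper Banach density in $(R,\cdot)$, then $A$ is combinatorially rich up to $\{\rho_r : r \in R\}$ in $(S,+)$, where $\rho_r : S \to S$ is $\rho_r(x) = xr$.
   Context: A semiring $(S,+,\cdot)$: $(S,+)$ commutative semigroup, $(S,\cdot)$ semigroup, both distributive laws hold. A semigroup $(T,\cdot)$ is left amenable if there is a left translation invariant mean on it, i.e. a positive linear functional $\lambda$ of norm $1$ on the bounded real functions on $T$ with $\lambda(x\mapsto f(tx)) = \lambda(f)$ for all bounded $f$ and $t \in T$; the upper Banach density of $B\subseteq T$ is $d^*(B) = \sup\{\lambda(\mathbb{1}_B) : \lambda \text{ a left translation invariant mean on } T\}$. For a matrix $\mathbf{M}=(M_{i,j}) \in S^{r\times n}$ and nonempty $\alpha \subseteq \{1,\dots,r\}$ let $M_{\alpha,j} = \sum_{i\in\alpha} M_{i,j}$. A set $B\subseteq S$ is combinatorially rich in $(S,+)$ if for every $n\in\mathbb{N}$ there is $r\in\mathbb{N}$ such that for every $\mathbf{M}\in S^{r\times n}$ there exist a nonempty $\alpha\subseteq\{1,\dots,r\}$ and $s\in S$ with $s + M_{\alpha,j} \in B$ for all $j\in\{1,\dots,n\}$. Given a set $\mathcal{E}$ of endomorphisms of $(S,+)$, $B$ is combinatorially rich up to $\mathcal{E}$ if for every $n$ there is $r$ such that for every $\mathbf{M}\in S^{r\times n}$ there exist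 nonempty $\alpha\subseteq\{1,\dots,r\}$, $\psi\in\mathcal{E}$ and $s\in S$ with $s+\psi(M_{\alpha,j})\in B$ for all $j\in\{1,\dots,n\}$. *)

theory Defs
  imports "HOL-Analysis.Analysis"
begin

text \<open>
  The type class \<^class>\<open>semiring\<close> requires exactly: commutative additive semigroup, multiplicative
  semigroup, both distributive laws (no zero, no unit). A semiring $S$ is a type of this class.
\<close>


section \<open>Sums over nonempty finite index sets in a commutative semigroup\<close>

text \<open>
  The library's \<^const>\<open>sum\<close> needs a zero, which \<open>S\<close> need not have. Hence the fold starts with the
  summand of the least index. The value is meaningful only for finite nonempty \<open>\<alpha>\<close>.
\<close>

definition ssum :: "(nat \<Rightarrow> 'a::ab_semigroup_add) \<Rightarrow> nat set \<Rightarrow> 'a" where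
  "ssum f \<alpha> = Finite_Set.fold (\<lambda>i s. f i + s) (f (Min \<alpha>)) (\<alpha> - {Min \<alpha>})"

lemma ssum_singleton [simp]: "ssum f {i} = f i"
  by (simp add: ssum_def)

lemma ssum_insert:
  assumes "finite \<alpha>" "\<alpha> \<noteq> {}" "i \<notin> \<alpha>"
  shows "ssum f (insert i \<alpha>) = f i + ssum f \<alpha>"
proof -
  interpret comp_fun_commute "\<lambda>i s. f i + s"
    by unfold_locales (auto simp: fun_eq_iff add.left_commute)
  have swap: "f j + Finite_Set.fold (\<lambda>i s. f i + s) (f k) B
      = f k + Finite_Set.fold (\<lambda>i s. f i + s) (f j) B" if "finite B" for j k B
    using that
  proof (induction B rule: finite_induct)
    case empty
    show ?case by (simp add: add.commute)
  next
    case (insert x B)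
    have "f j + Finite_Set.fold (\<lambda>i s. f i + s) (f k) (insert x B)
        = f x + (f j + Finite_Set.fold (\<lambda>i s. f i + s) (f k) B)"
      unfolding fold_insert[OF insert.hyps] by (rule add.left_commute)
    also have "\<dots> = f k + Finite_Set.fold (\<lambda>i s. f i + s) (f j) (insert x B)"
      unfolding insert.IH fold_insert[OF insert.hyps] by (rule add.left_commute)
    finally show ?case .
  qed
  show ?thesis
  proof (cases "i < Min \<alpha>")
    case True
    then have "Min (insert i \<alpha>) = i"
      using True Min_insert[OF assms(1,2), of i] by linarith
    then have "ssum f (insert i \<alpha>) = Finite_Set.fold (\<lambda>i s. f i + s) (f i) \<alpha>"
      using assms by (simp add: ssum_def)
    also have "\<dots> = f (Min \<alpha>) + Finite_Set.fold (\<lambda>i s. f i + s) (f i) (\<alpha> - {Min \<alpha>})"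
      using assms by (intro fold_rec) auto
    also have "\<dots> = f i + ssum f \<alpha>"
      unfolding ssum_def using assms by (intro swap) auto
    finally show ?thesis .
  next
    case False
    then have *: "Min (insert i \<alpha>) = Min \<alpha>"
      using False Min_insert[OF assms(1,2), of i] by linarith
    moreover have "i \<noteq> Min \<alpha>"
      using assms(3) Min_in[OF assms(1,2)] by auto
    ultimately show ?thesis
      using assms by (simp add: ssum_def insert_Diff_if)
  qed
qed

lemma ssum_eq_sum:
  fixes f :: "nat \<Rightarrow> 'a::comm_monoid_add"
  assumes "finite \<alpha>" "\<alpha> \<noteq> {}"
  shows "ssum f \<alpha> = sum f \<alpha>"
  using assms by (induction rule: finite_ne_induct) (simp_all add: ssum_insert)


section \<open>Combinatorial richness\<close>

text \<open>
  An $r \times n$ matrix is given by a function on pairs of indices, of which only the entries in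
  \<open>{1..r} \<times> {1..n}\<close> are used.
\<close>

definition combinatorially_rich :: "'a::ab_semigroup_add set \<Rightarrow> bool" where
  "combinatorially_rich B \<longleftrightarrow>
    (\<forall>n::nat\<ge>1. \<exists>r::nat\<ge>1. \<forall>M :: nat \<Rightarrow> nat \<Rightarrow> 'a.
      \<exists>\<alpha> s. \<alpha> \<noteq> {} \<and> \<alpha> \<subseteq> {1..r} \<and>
        (\<forall>j\<in>{1..n}. s + ssum (\<lambda>i. M i j) \<alpha> \<in> B))"

definition additive_endomorphism :: "('a::ab_semigroup_add \<Rightarrow> 'a) \<Rightarrow> bool" where
  "additive_endomorphism \<psi> \<longleftrightarrow> (\<forall>x y. \<psi> (x + y) = \<psi> x + \<psi> y)"

text \<open>The following is meant for sets \<open>E\<close> of additive endomorphisms.\<close>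

definition combinatorially_rich_upto ::
  "('a::ab_semigroup_add \<Rightarrow> 'a) set \<Rightarrow> 'a set \<Rightarrow> bool" where
  "combinatorially_rich_upto E B \<longleftrightarrow>
    (\<forall>n::nat\<ge>1. \<exists>r::nat\<ge>1. \<forall>M :: nat \<Rightarrow> nat \<Rightarrow> 'a.
      \<exists>\<alpha> \<psi> s. \<alpha> \<noteq> {} \<and> \<alpha> \<subseteq> {1..r} \<and> \<psi> \<in> E \<and>
        (\<forall>j\<in>{1..n}. s + \<psi> (ssum (\<lambda>i. M i j) \<alpha>) \<in> B))"

definition right_mult :: "'a::semiring \<Rightarrow> 'a \<Rightarrow> 'a" where
  "right_mult r x = x * r"

lemma additive_endomorphism_right_mult: "additive_endomorphism (right_mult r)"
  by (simp add: additive_endomorphism_def right_mult_def distrib_right)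


section \<open>Invariant means and upper Banach density\<close>

text \<open>
  \<open>T\<close> is the carrier of a multiplicative subsemigroup. A real function on \<open>T\<close> is represented by
  functions on the whole type. Positivity refers to values on \<open>T\<close> only, so together with
  linearity it makes \<open>m f\<close> depend only on the restriction of \<open>f\<close> to \<open>T\<close>.
  The set in the operator norm is bounded by \<open>m (\<lambda>_. 1)\<close>, again by positivity and linearity, so the
  supremum is a genuine one. For empty \<open>T\<close> there is no mean, since then \<open>m\<close> would vanish.
\<close>

definition mean_on :: "'a set \<Rightarrow> (('a \<Rightarrow> real) \<Rightarrow> real) \<Rightarrow> bool" where
  "mean_on T m \<longleftrightarrow>
    (\<forall>f g. bounded (f ` T) \<longrightarrow> bounded (g ` T) \<longrightarrow> m (\<lambda>x. f x + g x) = m f + m g) \<and>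
    (\<forall>c f. bounded (f ` T) \<longrightarrow> m (\<lambda>x. c * f x) = c * m f) \<and>
    (\<forall>f. bounded (f ` T) \<longrightarrow> (\<forall>x\<in>T. f x \<ge> 0) \<longrightarrow> m f \<ge> 0) \<and>
    (SUP f\<in>{f. \<forall>x\<in>T. \<bar>f x\<bar> \<le> 1}. \<bar>m f\<bar>) = 1"

definition left_invariant_mean_on :: "'a::semigroup_mult set \<Rightarrow> (('a \<Rightarrow> real) \<Rightarrow> real) \<Rightarrow> bool" where
  "left_invariant_mean_on T m \<longleftrightarrow> mean_on T m \<and>
    (\<forall>t\<in>T. \<forall>f. bounded (f ` T) \<longrightarrow> m (\<lambda>x. f (t * x)) = m f)"

definition left_amenable :: "'a::semigroup_mult set \<Rightarrow> bool" where
  "left_amenable T \<longleftrightarrow> (\<exists>m. left_invariant_mean_on T m)"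

definition upper_banach_density :: "'a::semigroup_mult set \<Rightarrow> 'a set \<Rightarrow> real" where
  "upper_banach_density T B = (SUP m\<in>{m. left_invariant_mean_on T m}. m (indicator B))"

end

theory Submission
  imports Defs
begin

text \<open>
  Let \<open>m\<close> be a left invariant mean with \<open>m(1\<^sub>A) = \<delta> > 0\<close>.  For finitely many \<open>t\<^sub>w \<in> R\<close> each of the
  functions \<open>x \<mapsto> 1\<^sub>A(t\<^sub>w x)\<close> has mean \<open>\<delta>\<close>, so some \<open>x \<in> R\<close> satisfies \<open>t\<^sub>w x \<in> A\<close> for a proportion of
  at least \<open>\<delta> / 2\<close> of the \<open>w\<close>.  Let \<open>w\<close> run over the words of length \<open>d\<close> on \<open>n\<close> letters.  Group
  the rows of the given matrix into blocks of \<open>d\<close> rows; summing, within each block, the entries in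
  row \<open>k\<close> and column \<open>w\<^sub>k\<close> over \<open>k\<close> gives a matrix with one column for each word.  Richness of \<open>R\<close>
  provides \<open>t\<^sub>w = s + (sum of some blocks of column w) \<in> R\<close>.  By the density Hales--Jewett theorem
  the words with \<open>t\<^sub>w x \<in> A\<close> contain a combinatorial line.  Its wildcard positions form \<open>\<alpha>\<close>; the
  remaining positions contribute a constant.

  The density Hales--Jewett theorem is proved by induction on the alphabet and density increment,
  with the uniform measure only (Dodos, Kanellopoulos, Tyros).  If \<open>A\<close> over \<open>k + 1\<close> letters contains
  no line, then \<open>A\<close> misses all \<open>x\<close> containing \<open>k\<close> such that replacing \<open>k\<close> by \<open>i\<close> in \<open>x\<close> gives an element of \<open>A\<close> for
  every \<open>i < k\<close>.  By the theorem for \<open>k\<close> letters and a Ramsey argument these \<open>x\<close> have density bounded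
  from below.  So \<open>A\<close> is denser on a piece of the complement that is an intersection of sets insensitive
  to exchanging \<open>i\<close> and \<open>k\<close>.  Again by the theorem for \<open>k\<close> letters, such sets are almost partitioned
  into subspaces, and \<open>A\<close> is denser on one of these.
\<close>

section \<open>Words and combinatorial subspaces\<close>

definition words :: "nat \<Rightarrow> nat \<Rightarrow> nat list set" where
  "words k n = {w. length w = n \<and> set w \<subseteq> {..<k}}"

text \<open>
  An \<open>m\<close>-dimensional combinatorial subspace is given by a template: \<open>Inl c\<close> is a fixed letter, \<open>Inr j\<close> the
  \<open>j\<close>-th variable, and every variable has to occur.
\<close>

definition templates :: "nat \<Rightarrow> nat \<Rightarrow> nat \<Rightarrow> (nat + nat) list set" where
  "templates k m n = {t. length t = n \<and> set t \<subseteq> Inl ` {..<k} \<union> Inr ` {..<m} \<and> Inr ` {..<m} \<subseteq> set t}"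

definition inst :: "(nat + nat) list \<Rightarrow> nat list \<Rightarrow> nat list" where
  "inst t w = map (case_sum id (\<lambda>j. w ! j)) t"

text \<open>Composition of templates (\<open>inst_tinst\<close>), so that a subspace of a subspace
  is again one of the whole cube (\<open>tinst_in_templates\<close>).\<close>

definition tinst :: "(nat + nat) list \<Rightarrow> (nat + nat) list \<Rightarrow> (nat + nat) list" where
  "tinst t s = map (case_sum Inl (\<lambda>j. s ! j)) t"

lemma finite_words [simp]: "finite (words k n)"
  using finite_lists_length_eq[of "{..<k}" n] by (simp add: words_def conj_commute)

lemma card_words [simp]: "card (words k n) = k ^ n"
  using card_lists_length_eq[of "{..<k}" n] by (simp add: words_def conj_commute)

lemma words_nonempty: "0 < k \<Longrightarrow> words k n \<noteq> {}"
  by (metis card_words card.empty power_not_zero less_numeral_extra(3))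

lemma words_0 [simp]: "words k 0 = {[]}"
  by (auto simp: words_def)

lemma Cons_in_words [simp]: "c # w \<in> words k (Suc n) \<longleftrightarrow> c < k \<and> w \<in> words k n"
  by (auto simp: words_def)

lemma append_in_words: "u \<in> words k a \<Longrightarrow> v \<in> words k b \<Longrightarrow> u @ v \<in> words k (a + b)"
  by (auto simp: words_def)

lemma nth_word_less: "w \<in> words k n \<Longrightarrow> j < n \<Longrightarrow> w ! j < k"
  using nth_mem[of j w] by (auto simp: words_def simp del: nth_mem)

lemma words_mono: "k \<le> k' \<Longrightarrow> words k n \<subseteq> words k' n"
  by (auto simp: words_def)

section \<open>Counting words by prefix and suffix\<close>

lemma words_append_image:
  "words k (a + b) = (\<lambda>(u, v). u @ v) ` (words k a \<times> words k b)"
proof -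
  have "\<exists>x\<in>words k a \<times> words k b. w = (case x of (u, v) \<Rightarrow> u @ v)" if "w \<in> words k (a + b)" for w
    using that
    by (intro bexI[of _ "(take a w, drop a w)"])
       (auto simp: words_def dest: in_set_takeD in_set_dropD)
  then show ?thesis by (auto simp: append_in_words)
qed

lemma inj_on_append_words: "inj_on (\<lambda>(u, v). u @ v) (words k a \<times> words k b)"
  by (auto simp: inj_on_def words_def)

lemma card_words_append:
  "card {w \<in> words k (a + b). P w} = (\<Sum>u\<in>words k a. card {v \<in> words k b. P (u @ v)})"
proof -
  have "{w \<in> words k (a + b). P w}
      = (\<lambda>(u, v). u @ v) ` (SIGMA u:words k a. {v \<in> words k b. P (u @ v)})"
    unfolding words_append_image by auto
  moreover have "inj_on (\<lambda>(u, v). u @ v) (SIGMA u:words k a. {v \<in> words k b. P (u @ v)})"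
    by (rule inj_on_subset[OF inj_on_append_words]) auto
  ultimately show ?thesis by (simp add: card_image)
qed

lemma sum_card_swap:
  assumes "finite X" "finite Y"
  shows "(\<Sum>x\<in>X. card {y\<in>Y. P x y}) = (\<Sum>y\<in>Y. card {x\<in>X. P x y})"
proof -
  have "(\<Sum>x\<in>X. card {y\<in>Y. P x y}) = (\<Sum>x\<in>X. \<Sum>y\<in>Y. if P x y then 1 else 0)"
    using assms by (simp add: sum.If_cases Int_def)
  also have "\<dots> = (\<Sum>y\<in>Y. \<Sum>x\<in>X. if P x y then 1 else 0)"
    by (rule sum.swap)
  also have "\<dots> = (\<Sum>y\<in>Y. card {x\<in>X. P x y})"
    using assms by (simp add: sum.If_cases Int_def)
  finally show ?thesis .
qed

lemma card_words_append':
  "card {w \<in> words k (a + b). P w} = (\<Sum>v\<in>words k b. card {u \<in> words k a. P (u @ v)})"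
  unfolding card_words_append by (rule sum_card_swap) simp_all

lemma finite_templates [simp]: "finite (templates k m n)"
  by (rule finite_subset[OF _ finite_lists_length_eq[of "Inl ` {..<k} \<union> Inr ` {..<m}" n]])
     (auto simp: templates_def)

lemma templates_mono: "k \<le> k' \<Longrightarrow> templates k m n \<subseteq> templates k' m n"
  by (auto simp: templates_def)

lemma length_inst [simp]: "length (inst t w) = length t"
  by (simp add: inst_def)

lemma length_tinst [simp]: "length (tinst t s) = length t"
  by (simp add: tinst_def)

lemma length_template: "t \<in> templates k m n \<Longrightarrow> length t = n"
  by (simp add: templates_def)

lemma length_word: "w \<in> words k n \<Longrightarrow> length w = n"
  by (simp add: words_def)

lemma inst_append [simp]: "inst (t @ t') w = inst t w @ inst t' w"
  by (simp add: inst_def)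

lemma inst_Cons [simp]: "inst (Inl c # t) w = c # inst t w" "inst (Inr j # t) w = w ! j # inst t w"
  by (simp_all add: inst_def)

lemma inst_Nil [simp]: "inst [] w = []"
  by (simp add: inst_def)

lemma inst_map_Inl [simp]: "inst (map Inl u) w = u"
  by (simp add: inst_def comp_def)

lemma tinst_append [simp]: "tinst (t @ t') w = tinst t w @ tinst t' w"
  by (simp add: tinst_def)

lemma tinst_Cons [simp]: "tinst (Inr j # t) s = s ! j # tinst t s"
  by (simp add: tinst_def)

lemma tinst_map_Inl [simp]: "tinst (map Inl u) w = map Inl u"
  by (simp add: tinst_def comp_def)

lemma inst_in_words:
  assumes "t \<in> templates k m n" "w \<in> words k m"
  shows "inst t w \<in> words k n"
proof -
  have "w ! j < k" if "j < m" for j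
    using assms(2) that by (rule nth_word_less)
  then have "case_sum id (\<lambda>j. w ! j) a < k" if "a \<in> set t" for a
    using assms(1) that by (auto simp: templates_def)
  then show ?thesis using assms(1) by (auto simp: templates_def words_def inst_def)
qed

lemma inst_tinst:
  assumes "t \<in> templates k m n" "length s = m"
  shows "inst (tinst t s) w = inst t (inst s w)"
  using assms by (fastforce simp: templates_def inst_def tinst_def split: sum.splits)

lemma tinst_tinst:
  assumes "t \<in> templates k m n" "length s = m"
  shows "tinst (tinst t s) r = tinst t (tinst s r)"
  using assms by (fastforce simp: templates_def tinst_def split: sum.splits)

lemma tinst_in_templates:
  assumes "t \<in> templates k m n" "s \<in> templates k l m"
  shows "tinst t s \<in> templates k l n"
proof -
  have 1: "set (tinst t s) \<subseteq> Inl ` {..<k} \<union> Inr ` {..<l}"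
  proof -
    have *: "s ! j \<in> Inl ` {..<k} \<union> Inr ` {..<l}" if "j < m" for j
      using assms(2) that nth_mem[of j s] unfolding templates_def by (blast intro: nth_mem)
    have "case_sum Inl (\<lambda>j. s ! j) a \<in> Inl ` {..<k} \<union> Inr ` {..<l}" if "a \<in> set t" for a
    proof (cases a)
      case (Inl c)
      then show ?thesis using assms(1) that by (auto simp: templates_def)
    next
      case (Inr j)
      then show ?thesis using assms(1) that * by (auto simp: templates_def)
    qed
    then show ?thesis by (auto simp: tinst_def)
  qed
  have "Inr j \<in> set (tinst t s)" if "j < l" for j
  proof -
    have "Inr j \<in> set s" using assms(2) that by (auto simp: templates_def)
    then obtain i where i: "i < m" "s ! i = Inr j"
      using assms(2) by (auto simp: templates_def in_set_conv_nth)
    then have "Inr i \<in> set t" using assms(1) by (auto simp: templates_def)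
    then have "case_sum Inl (\<lambda>j. s ! j) (Inr i) \<in> set (tinst t s)"
      unfolding tinst_def by (simp only: set_map image_eqI)
    then show ?thesis using i by simp
  qed
  with 1 show ?thesis using assms by (auto simp: templates_def)
qed

text \<open>Every variable occurs in \<open>t\<close>, so each letter of the word can be read off
  from its image.\<close>

lemma inj_on_inst: "t \<in> templates k m n \<Longrightarrow> inj_on (inst t) (words k m)"
proof (rule inj_onI)
  fix x y assume t: "t \<in> templates k m n" and xy: "x \<in> words k m" "y \<in> words k m" "inst t x = inst t y"
  show "x = y"
  proof (rule nth_equalityI)
    show "length x = length y" using xy by (simp add: words_def)
    fix i assume "i < length x"
    then have "Inr i \<in> set t" using t xy by (auto simp: templates_def words_def)
    moreover have "\<forall>a\<in>set t. case_sum id (\<lambda>j. x ! j) a = case_sum id (\<lambda>j. y ! j) a"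
      using xy(3) by (simp add: inst_def)
    ultimately show "x ! i = y ! i" by fastforce
  qed
qed

section \<open>Special templates and products of subspaces\<close>

definition id_template :: "nat \<Rightarrow> (nat + nat) list" where
  "id_template m = map Inr [0..<m]"

lemma id_template_in_templates [simp]: "id_template m \<in> templates k m m"
  by (auto simp: id_template_def templates_def)

lemma inst_id_template [simp]: "length w = m \<Longrightarrow> inst (id_template m) w = w"
  by (auto simp: id_template_def inst_def intro!: nth_equalityI)

lemma tinst_id_template [simp]: "length w = m \<Longrightarrow> tinst (id_template m) w = w"
  by (auto simp: id_template_def tinst_def intro!: nth_equalityI)

text \<open>Serves to lower a dimension from \<open>a + b\<close> to \<open>a\<close>.\<close>

definition freeze :: "nat \<Rightarrow> nat \<Rightarrow> (nat + nat) list" where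
  "freeze a b = id_template a @ replicate b (Inl 0)"

lemma freeze_in_templates: "0 < k \<Longrightarrow> freeze a b \<in> templates k a (a + b)"
  by (auto simp: freeze_def id_template_def templates_def)

lemma prefix_in_templates:
  "u \<in> words k a \<Longrightarrow> t \<in> templates k m n \<Longrightarrow> map Inl u @ t \<in> templates k m (a + n)"
  by (auto simp: words_def templates_def)

lemma suffix_in_templates:
  "u \<in> words k a \<Longrightarrow> t \<in> templates k m n \<Longrightarrow> t @ map Inl u \<in> templates k m (n + a)"
  by (auto simp: words_def templates_def)

text \<open>Product of two subspaces. The variables of \<open>s\<close> are shifted by
  \<open>a\<close>, so that \<open>u @ v\<close> with \<open>length u = a\<close> hands
  \<open>u\<close> to \<open>t\<close> and \<open>v\<close> to \<open>s\<close>.\<close>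

definition tjoin :: "nat \<Rightarrow> (nat + nat) list \<Rightarrow> (nat + nat) list \<Rightarrow> (nat + nat) list" where
  "tjoin a t s = t @ map (case_sum Inl (\<lambda>j. Inr (a + j))) s"

lemma inst_tjoin:
  assumes "t \<in> templates k a n" "length u = a"
  shows "inst (tjoin a t s) (u @ v) = inst t u @ inst s v"
proof -
  have "inst t (u @ v) = inst t u"
    using assms by (auto simp: templates_def inst_def nth_append)
  moreover have "inst (map (case_sum Inl (\<lambda>j. Inr (a + j))) s) (u @ v) = inst s v"
    using assms(2) by (auto simp: inst_def nth_append split: sum.splits)
  ultimately show ?thesis by (simp add: tjoin_def)
qed

lemma tinst_tjoin:
  assumes "t \<in> templates k a n" "length u = a"
  shows "tinst (tjoin a t s) (u @ v) = tinst t u @ tinst s v"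
proof -
  have "tinst t (u @ v) = tinst t u"
    using assms by (auto simp: templates_def tinst_def nth_append)
  moreover have "tinst (map (case_sum Inl (\<lambda>j. Inr (a + j))) s) (u @ v) = tinst s v"
    using assms(2) by (auto simp: tinst_def nth_append split: sum.splits)
  ultimately show ?thesis by (simp add: tjoin_def)
qed

lemma tjoin_in_templates:
  assumes "t \<in> templates k a n" "s \<in> templates k b n'"
  shows "tjoin a t s \<in> templates k (a + b) (n + n')"
proof -
  have "Inr j \<in> set (tjoin a t s)" if "j < a + b" for j
  proof (cases "j < a")
    case True
    then show ?thesis using assms(1) by (auto simp: templates_def tjoin_def)
  next
    case False
    then have "Inr (j - a) \<in> set s" using assms(2) that by (auto simp: templates_def)
    then have "case_sum Inl (\<lambda>j. Inr (a + j)) (Inr (j - a)) \<in> set (tjoin a t s)"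
      unfolding tjoin_def set_append set_map by blast
    then show ?thesis using False by simp
  qed
  moreover have "set (tjoin a t s) \<subseteq> Inl ` {..<k} \<union> Inr ` {..<a + b}"
  proof -
    have "case_sum Inl (\<lambda>j. Inr (a + j)) x \<in> Inl ` {..<k} \<union> Inr ` {..<a + b}" if "x \<in> set s" for x
    proof (cases x)
      case (Inl c)
      then show ?thesis using that assms(2) by (auto simp: templates_def)
    next
      case (Inr j)
      then show ?thesis using that assms(2) by (auto simp: templates_def)
    qed
    moreover have "set t \<subseteq> Inl ` {..<k} \<union> Inr ` {..<a + b}"
      using assms(1) by (force simp: templates_def)
    ultimately show ?thesis unfolding tjoin_def by auto
  qed
  ultimately show ?thesis using assms by (auto simp: templates_def tjoin_def)
qed

section \<open>Lines, averaging and pigeonhole\<close>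

definition has_line :: "nat \<Rightarrow> nat \<Rightarrow> nat list set \<Rightarrow> bool" where
  "has_line k n A \<longleftrightarrow> (\<exists>t\<in>templates k 1 n. \<forall>c<k. inst t [c] \<in> A)"

lemma has_line_inst:
  assumes "t \<in> templates k m n" "has_line k m {w. inst t w \<in> A}"
  shows "has_line k n A"
proof -
  from assms(2) obtain s where s: "s \<in> templates k 1 m" "\<forall>c<k. inst t (inst s [c]) \<in> A"
    by (auto simp: has_line_def)
  show ?thesis unfolding has_line_def
  proof (intro bexI allI impI)
    show "tinst t s \<in> templates k 1 n" using assms s by (blast intro: tinst_in_templates)
    show "inst (tinst t s) [c] \<in> A" if "c < k" for c
      using s that inst_tinst[OF assms(1) length_template[OF s(1)]] by simp
  qed
qed

text \<open>Elements \<open>y\<close> below the threshold account for at most half of the assumed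
  total. The rest comes from the others, each of which contributes at most
  \<open>card X\<close>.\<close>

lemma average_fibre:
  fixes d :: real
  assumes "finite X" "X \<noteq> {}" "finite Y" "0 \<le> d"
    and "d * card X * card Y \<le> (\<Sum>y\<in>Y. real (card {x\<in>X. P x y}))"
  shows "d / 2 * card Y \<le> card {y\<in>Y. d / 2 * card X \<le> card {x\<in>X. P x y}}"
proof -
  define Z where "Z = {y\<in>Y. d / 2 * card X \<le> card {x\<in>X. P x y}}"
  have "d * card X * card Y \<le> (\<Sum>y\<in>Y. real (card {x\<in>X. P x y}))" by fact
  also have "\<dots> \<le> (\<Sum>y\<in>Y. d / 2 * card X + (if y \<in> Z then real (card X) else 0))"
  proof (rule sum_mono)
    fix y assume "y \<in> Y"
    have "real (card {x\<in>X. P x y}) \<le> card X" using assms(1) by (auto intro: card_mono)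
    then show "real (card {x\<in>X. P x y}) \<le> d / 2 * card X + (if y \<in> Z then real (card X) else 0)"
      using \<open>y \<in> Y\<close> assms(4) by (auto simp: Z_def intro: add_increasing)
  qed
  also have "\<dots> = d / 2 * card X * card Y + card X * card Z"
  proof -
    have "(\<Sum>y\<in>Y. if y \<in> Z then real (card X) else 0) = card X * card Z"
      using assms(3) by (simp add: sum.If_cases Z_def Int_def)
    then show ?thesis by (simp add: sum.distrib algebra_simps)
  qed
  finally have "real (card X) * (d / 2 * card Y) \<le> card X * card Z" by (simp add: algebra_simps)
  then show ?thesis using assms(1,2) by (simp add: Z_def card_gt_0_iff)
qed

lemma pigeonhole_choice:
  assumes "finite T" "finite Y" "\<And>y. y \<in> Y \<Longrightarrow> \<exists>t\<in>T. Q t y" "T \<noteq> {}"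
  shows "\<exists>t\<in>T. real (card Y) \<le> card T * card {y\<in>Y. Q t y}"
proof (rule ccontr)
  assume "\<not> ?thesis"
  then have *: "card T * card {y\<in>Y. Q t y} < card Y" if "t \<in> T" for t
    using that by (metis (mono_tags, lifting) linorder_not_le of_nat_le_iff)
  have "card T * card Y \<le> card T * (\<Sum>t\<in>T. card {y\<in>Y. Q t y})"
  proof -
    have "Y = (\<Union>t\<in>T. {y\<in>Y. Q t y})" using assms(3) by auto
    then show ?thesis by (metis card_UN_le[OF assms(1)] mult_le_mono2)
  qed
  also have "\<dots> < card T * card Y"
    using * assms(1,4) sum_strict_mono[of T "\<lambda>t. card T * card {y\<in>Y. Q t y}" "\<lambda>_. card Y"]
    by (simp add: sum_distrib_left)
  finally show False by simp
qed

section \<open>The Hales--Jewett theorem\<close>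

text \<open>For \<open>i < k\<close> the fibres of this projection are the classes of words that
  differ by exchanging \<open>i\<close> and \<open>k\<close> at some positions. So insensitivity to
  such exchanges can be expressed by a single map.\<close>

definition merge :: "nat \<Rightarrow> nat \<Rightarrow> nat list \<Rightarrow> nat list" where
  "merge i k w = map (\<lambda>c. if c = k then i else c) w"

lemma merge_append [simp]: "merge i k (u @ v) = merge i k u @ merge i k v"
  by (simp add: merge_def)

lemma merge_in_words: "i < k \<Longrightarrow> w \<in> words (Suc k) n \<Longrightarrow> merge i k w \<in> words k n"
  by (fastforce simp: merge_def words_def less_Suc_eq)

lemma merge_in_words_Suc: "i < k \<Longrightarrow> w \<in> words (Suc k) n \<Longrightarrow> merge i k w \<in> words (Suc k) n"
  using merge_in_words words_mono[of k "Suc k" n] by auto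

lemma merge_merge [simp]: "i < k \<Longrightarrow> merge i k (merge i k w) = merge i k w"
  by (simp add: merge_def)

lemma merge_inst:
  assumes "t \<in> templates k m n" "length w = m"
  shows "merge i k (inst t w) = inst t (merge i k w)"
  using assms by (auto simp: templates_def inst_def merge_def)

text \<open>The Hales--Jewett statements colour by numbers below \<open>c\<close>, while the colours
  arising in the proofs are functions or sets. Enumerating the colours translates between the
  two.\<close>

lemma colour_nat:
  fixes \<kappa> :: "'b \<Rightarrow> 'c"
  assumes "finite C" "card C \<le> c" "\<forall>w\<in>W. \<kappa> w \<in> C"
  obtains \<kappa>' :: "'b \<Rightarrow> nat" where "\<forall>w\<in>W. \<kappa>' w < c"
    "\<And>w w'. w \<in> W \<Longrightarrow> w' \<in> W \<Longrightarrow> \<kappa>' w = \<kappa>' w' \<longleftrightarrow> \<kappa> w = \<kappa> w'"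
proof -
  obtain h where h: "bij_betw h C {0..<card C}"
    using ex_bij_betw_finite_nat[OF assms(1)] by blast
  show ?thesis
  proof (rule that[of "h \<circ> \<kappa>"])
    show "\<forall>w\<in>W. (h \<circ> \<kappa>) w < c" 
    proof
      fix w assume "w \<in> W"
      then have "h (\<kappa> w) \<in> {0..<card C}" using h assms(3) by (auto simp: bij_betw_def)
      then show "(h \<circ> \<kappa>) w < c" using assms(2) by simp
    qed
    show "(h \<circ> \<kappa>) w = (h \<circ> \<kappa>) w' \<longleftrightarrow> \<kappa> w = \<kappa> w'" if "w \<in> W" "w' \<in> W" for w w'
      using h assms(3) that by (auto simp: bij_betw_def inj_on_eq_iff)
  qed
qed

text \<open>Shelah's argument: a block of letters \<open>i\<close> followed by a block of letters \<open>k\<close>; by the pigeonhole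
  principle two positions of the border are indistinguishable for the colouring.\<close>

lemma insensitive_subspace:
  assumes "i < k"
  shows "\<exists>n. \<forall>\<kappa>. (\<forall>w\<in>words (Suc k) n. \<kappa> w < (c::nat)) \<longrightarrow>
    (\<exists>t\<in>templates (Suc k) m n. \<forall>w\<in>words (Suc k) m. \<kappa> (inst t w) = \<kappa> (inst t (merge i k w)))"
proof (induction m arbitrary: c)
  case 0
  show ?case
    by (intro exI[of _ 0] allI impI bexI[of _ "[]"]) (auto simp: merge_def templates_def)
next
  case (Suc m)
  let ?K = "Suc k"
  obtain n where n: "\<And>\<kappa>. (\<forall>w\<in>words ?K n. \<kappa> w < c ^ ?K) \<Longrightarrow>
    (\<exists>t\<in>templates ?K m n. \<forall>w\<in>words ?K m. \<kappa> (inst t w) = \<kappa> (inst t (merge i k w)))"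
    using Suc.IH[of "c ^ ?K"] by auto
  \<comment> \<open>The number of colourings of \<open>words ?K n\<close> with \<open>c\<close>
    colours. So two of the \<open>L + 1\<close> border positions induce the same colouring of the
    tails.\<close>
  define L where "L = c ^ (?K ^ n)"
  have "\<exists>t\<in>templates ?K (Suc m) (L + n). \<forall>w\<in>words ?K (Suc m).
          \<kappa> (inst t w) = \<kappa> (inst t (merge i k w))"
    if \<kappa>: "\<forall>w\<in>words ?K (L + n). \<kappa> w < c" for \<kappa>
  proof -
    define b where "b p = replicate p i @ replicate (L - p) k" for p
    have b: "b p \<in> words ?K L" if "p \<le> L" for p
      using that assms by (auto simp: b_def words_def)
    define f where "f p = restrict (\<lambda>v. \<kappa> (b p @ v)) (words ?K n)" for p
    have "f ` {..L} \<subseteq> words ?K n \<rightarrow>\<^sub>E {..<c}"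
      using \<kappa> b append_in_words unfolding f_def by (auto simp: PiE_def)
    moreover have "card (words ?K n \<rightarrow>\<^sub>E {..<c}) < card {..L}"
      by (simp add: card_funcsetE L_def)
    ultimately have "\<not> inj_on f {..L}"
      by (metis card_inj_on_le finite_PiE finite_lessThan finite_words leD)
    then obtain p p' where p: "p < p'" "p' \<le> L" "f p = f p'"
      unfolding inj_on_def by (metis atMost_iff linorder_neqE_nat)
    \<comment> \<open>Wild exactly between the two border positions: the letter \<open>k\<close>
      gives the block \<open>b p\<close>, the letter \<open>i\<close> gives
      \<open>b p'\<close>.\<close>
    define l :: "(nat + nat) list" where "l = map Inl (replicate p i) @ replicate (p' - p) (Inr 0) @ map Inl (replicate (L - p') k)"
    have "l \<in> templates ?K 1 L" using p assms by (auto simp: l_def templates_def)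
    have l_eq: "\<kappa> (inst l [k] @ v) = \<kappa> (inst l [i] @ v)" if "v \<in> words ?K n" for v
    proof -
      have "inst l [k] = b p" "inst l [i] = b p'"
        using p by (auto simp: l_def b_def inst_def map_replicate_const simp flip: replicate_add)
      then show ?thesis using fun_cong[OF p(3), of v] that by (simp add: f_def)
    qed
    \<comment> \<open>A tail is coloured by its colours for all values of the first variable at
      once. This makes at most \<open>c ^ ?K\<close> new colours, the number used in the induction
      hypothesis.\<close>
    define g where "g v = restrict (\<lambda>a. \<kappa> (inst l [a] @ v)) {..<?K}" for v
    have g: "\<forall>v\<in>words ?K n. g v \<in> {..<?K} \<rightarrow>\<^sub>E {..<c}"
    proof -
      have "inst l [a] @ v \<in> words ?K (L + n)" if "v \<in> words ?K n" "a < ?K" for a v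
        using that by (intro append_in_words inst_in_words[OF \<open>l \<in> templates ?K 1 L\<close>])
          (auto simp: words_def)
      then show ?thesis using \<kappa> unfolding g_def by (auto simp: PiE_def)
    qed
    obtain g' :: "nat list \<Rightarrow> nat" where g': "\<forall>v\<in>words ?K n. g' v < c ^ ?K"
      "\<And>v v'. v \<in> words ?K n \<Longrightarrow> v' \<in> words ?K n \<Longrightarrow> g' v = g' v' \<longleftrightarrow> g v = g v'"
      by (rule colour_nat[OF _ _ g, of "c ^ ?K"]) (auto simp: card_funcsetE finite_PiE)
    obtain t where t: "t \<in> templates ?K m n" "\<forall>w\<in>words ?K m. g' (inst t w) = g' (inst t (merge i k w))"
      using n[OF g'(1)] by blast
    define T where "T = tjoin 1 l t"
    have inst_T: "inst T (a # w) = inst l [a] @ inst t w" for a w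
      using inst_tjoin[OF \<open>l \<in> templates ?K 1 L\<close>, of "[a]" t w] by (simp add: T_def)
    show ?thesis
    proof (intro bexI ballI)
      show "T \<in> templates ?K (Suc m) (L + n)"
        using tjoin_in_templates[OF \<open>l \<in> templates ?K 1 L\<close> t(1)] by (simp add: T_def)
      fix w assume "w \<in> words ?K (Suc m)"
      then obtain a v where w: "w = a # v" "a < ?K" "v \<in> words ?K m"
        by (cases w) (auto simp: words_def)
      have v: "inst t v \<in> words ?K n" "inst t (merge i k v) \<in> words ?K n"
        using w t(1) assms by (auto intro!: inst_in_words merge_in_words_Suc)
      have "g (inst t v) = g (inst t (merge i k v))" using t(2) w(3) g'(2) v by auto
      from fun_cong[OF this, of a]
      have "\<kappa> (inst l [a] @ inst t v) = \<kappa> (inst l [a] @ inst t (merge i k v))"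
        using w(2) by (simp add: g_def)
      also have "\<dots> = \<kappa> (inst l [if a = k then i else a] @ inst t (merge i k v))"
        using l_eq v(2) by simp
      finally show "\<kappa> (inst T w) = \<kappa> (inst T (merge i k w))"
        by (simp add: w(1) merge_def inst_T)
    qed
  qed
  then show ?case by blast
qed

text \<open>Induction on the alphabet. On a subspace insensitive to exchanging 0 and
  \<open>k\<close>, a word has the colour of the word with \<open>k\<close> merged into 0, so the
  statement for \<open>k\<close> letters inside this subspace suffices.\<close>

theorem Hales_Jewett:
  assumes "0 < k"
  shows "\<exists>n. \<forall>\<kappa>. (\<forall>w\<in>words k n. \<kappa> w < (c::nat)) \<longrightarrow>
    (\<exists>t\<in>templates k m n. \<forall>v\<in>words k m. \<forall>w\<in>words k m. \<kappa> (inst t v) = \<kappa> (inst t w))"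
  using assms
proof (induction k rule: nat_induct_non_zero)
  case 1
  have "v = w" if "v \<in> words 1 m" "w \<in> words 1 m" for v w
    using that by (intro nth_equalityI) (auto simp: length_word dest!: nth_word_less)
  then show ?case by (intro exI[of _ m] allI impI bexI[of _ "id_template m"]) auto
next
  case (Suc k)
  then obtain N where N: "\<And>\<kappa>. (\<forall>w\<in>words k N. \<kappa> w < c) \<Longrightarrow>
    (\<exists>t\<in>templates k m N. \<forall>v\<in>words k m. \<forall>w\<in>words k m. \<kappa> (inst t v) = \<kappa> (inst t w))"
    by auto
  obtain n where n: "\<And>\<kappa>. (\<forall>w\<in>words (Suc k) n. \<kappa> w < c) \<Longrightarrow>
    (\<exists>t\<in>templates (Suc k) N n. \<forall>w\<in>words (Suc k) N. \<kappa> (inst t w) = \<kappa> (inst t (merge 0 k w)))"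
    using insensitive_subspace[of 0 k c N] Suc.hyps by auto
  show ?case
  proof (intro exI[of _ n] allI impI)
    fix \<kappa> assume \<kappa>: "\<forall>w\<in>words (Suc k) n. \<kappa> w < c"
    obtain t where t: "t \<in> templates (Suc k) N n"
      "\<And>w. w\<in>words (Suc k) N \<Longrightarrow> \<kappa> (inst t w) = \<kappa> (inst t (merge 0 k w))"
      using n[OF \<kappa>] by blast
    have "\<forall>w\<in>words k N. \<kappa> (inst t w) < c"
      using \<kappa> inst_in_words[OF t(1)] words_mono[of k "Suc k" N] by auto
    then obtain s where s: "s \<in> templates k m N"
      "\<And>v w. v \<in> words k m \<Longrightarrow> w \<in> words k m \<Longrightarrow> \<kappa> (inst t (inst s v)) = \<kappa> (inst t (inst s w))"
      using N[of "\<lambda>w. \<kappa> (inst t w)"] by blast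
    have s': "s \<in> templates (Suc k) m N" using s(1) templates_mono[of k "Suc k"] by auto
    show "\<exists>t\<in>templates (Suc k) m n. \<forall>v\<in>words (Suc k) m. \<forall>w\<in>words (Suc k) m. \<kappa> (inst t v) = \<kappa> (inst t w)"
    proof (intro bexI ballI)
      show "tinst t s \<in> templates (Suc k) m n" using t(1) s' by (rule tinst_in_templates)
      have *: "\<kappa> (inst (tinst t s) v) = \<kappa> (inst t (inst s (merge 0 k v)))" if "v \<in> words (Suc k) m" for v
        using t(2)[of "inst s v"] inst_in_words[OF s' that] merge_inst[OF s(1) length_word[OF that], of 0]
          inst_tinst[OF t(1) length_template[OF s(1)], of v] by simp
      show "\<kappa> (inst (tinst t s) v) = \<kappa> (inst (tinst t s) w)" if "v \<in> words (Suc k) m" "w \<in> words (Suc k) m" for v w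
        using * that s(2) merge_in_words[OF Suc.hyps] by auto
    qed
  qed
qed

section \<open>Density on fibres\<close>

definition DHJ :: "nat \<Rightarrow> real \<Rightarrow> nat \<Rightarrow> bool" where
  "DHJ k d n \<longleftrightarrow> (\<forall>A\<subseteq>words k n. d * real k ^ n \<le> card A \<longrightarrow> has_line k n A)"

lemma card_fibres_append:
  assumes "A \<subseteq> words k (a + b)"
  shows "card A = (\<Sum>u\<in>words k a. card {v \<in> words k b. u @ v \<in> A})"
proof -
  have "A = {w \<in> words k (a + b). w \<in> A}" using assms by auto
  then show ?thesis using card_words_append[of k a b "\<lambda>w. w \<in> A"] by simp
qed

text \<open>If some fibre over a block of \<open>m\<close> letters is too sparse, then some other fibre is denser than
  average; this increment can only occur boundedly often.\<close>

lemma dense_fibres: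
  assumes "0 < e" "0 < k"
  shows "\<exists>n. \<forall>A\<subseteq>words k n. d * real k ^ n \<le> card A \<longrightarrow>
    (\<exists>p u q. n = p + m + q \<and> u \<in> words k p \<and>
      (\<forall>t\<in>words k m. (d - e) * real k ^ q \<le> card {y\<in>words k q. u @ t @ y \<in> A}))"
proof -
  \<comment> \<open>A deficit of \<open>e\<close> on one of the \<open>k ^ m\<close> fibres forces
    an excess of at least \<open>e / k ^ m\<close> on some other one.\<close>
  define g where "g = e / real k ^ m"
  have g: "0 < g" using assms by (simp add: g_def)
  \<comment> \<open>\<open>j\<close> bounds the number of increments still possible: each raises the
    density by \<open>g\<close> and uses up \<open>m\<close> letters, and the density cannot exceed
    1.\<close>
  have *: "\<forall>A\<subseteq>words k (m * j). d * real k ^ (m * j) \<le> card A \<longrightarrow>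
    (\<exists>p u q. m * j = p + m + q \<and> u \<in> words k p \<and>
      (\<forall>t\<in>words k m. (d - e) * real k ^ q \<le> card {y\<in>words k q. u @ t @ y \<in> A}))"
    if "1 < d + j * g" for d j
    using that
  proof (induction j arbitrary: d)
    case 0
    have "card A \<le> 1" if "A \<subseteq> words k (m * 0)" for A
      using card_mono[OF finite_words that] by simp
    moreover have "\<not> d \<le> real c" if "c \<le> 1" for c :: nat
      using 0 that by simp
    ultimately show ?case by (metis mult.right_neutral mult_0_right power_0)
  next
    case (Suc j)
    let ?q = "m * j"
    show ?case
    proof (intro allI impI)
      fix A assume A: "A \<subseteq> words k (m * Suc j)" "d * real k ^ (m * Suc j) \<le> card A"
      define F where "F t = {y\<in>words k ?q. t @ y \<in> A}" for t
      have cA: "real (card A) = (\<Sum>t\<in>words k m. real (card (F t)))"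
        using card_fibres_append[of A k m ?q] A(1) by (simp add: F_def)
      show "\<exists>p u q. m * Suc j = p + m + q \<and> u \<in> words k p \<and>
        (\<forall>t\<in>words k m. (d - e) * real k ^ q \<le> card {y\<in>words k q. u @ t @ y \<in> A})"
      proof (cases "\<forall>t\<in>words k m. (d - e) * real k ^ ?q \<le> card (F t)")
        case True
        then show ?thesis by (intro exI[of _ 0] exI[of _ "[]"] exI[of _ ?q]) (simp add: F_def)
      next
        case False
        then obtain t0 where t0: "t0 \<in> words k m" "card (F t0) < (d - e) * real k ^ ?q"
          by auto
        have "\<exists>t\<in>words k m. (d + g) * real k ^ ?q \<le> card (F t)"
        proof (rule ccontr)
          assume "\<not> ?thesis"
          then have "(\<Sum>t\<in>words k m - {t0}. real (card (F t)))
              \<le> (\<Sum>t\<in>words k m - {t0}. (d + g) * real k ^ ?q)"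
            by (intro sum_mono) auto
          also have "\<dots> = (real k ^ m - 1) * ((d + g) * real k ^ ?q)"
            using t0(1) assms(2) by (simp add: card_Diff_singleton of_nat_diff)
          finally have "card A < (d - e) * real k ^ ?q + (real k ^ m - 1) * ((d + g) * real k ^ ?q)"
            using t0 unfolding cA by (simp add: sum.remove[OF finite_words t0(1)])
          also have "\<dots> = (real k ^ m * d - g) * real k ^ ?q"
            using assms(2) by (simp add: g_def field_simps)
          also have "\<dots> \<le> d * real k ^ (m * Suc j)"
            using g by (simp add: power_add algebra_simps)
          finally show False using A(2) by simp
        qed
        then obtain t where t: "t \<in> words k m" "(d + g) * real k ^ ?q \<le> card (F t)" by auto
        have "1 < (d + g) + j * g" using Suc.prems by (simp add: algebra_simps)
        from Suc.IH[OF this, rule_format, of "F t"] t(2)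
        obtain p u q where u: "?q = p + m + q" "u \<in> words k p"
          "\<And>t'. t'\<in>words k m \<Longrightarrow> (d + g - e) * real k ^ q \<le> card {y\<in>words k q. u @ t' @ y \<in> F t}"
          unfolding F_def by blast
        have "(d - e) * real k ^ q \<le> card {y\<in>words k q. (t @ u) @ t' @ y \<in> A}" if "t' \<in> words k m" for t'
        proof -
          have "(d - e) * real k ^ q \<le> (d + g - e) * real k ^ q"
            using g by (intro mult_right_mono) auto
          also have "\<dots> \<le> card {y\<in>words k q. u @ t' @ y \<in> F t}" by (rule u(3)[OF that])
          also have "\<dots> \<le> card {y\<in>words k q. (t @ u) @ t' @ y \<in> A}"
            by (intro of_nat_mono card_mono) (auto simp: F_def)
          finally show ?thesis .
        qed
        then show ?thesis using u(1,2) t(1)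
          by (intro exI[of _ "m + p"] exI[of _ "t @ u"] exI[of _ q])
             (simp add: append_in_words)
      qed
    qed
  qed
  obtain j :: nat where "(1 - d) / g < j" using reals_Archimedean2 by blast
  then have "1 < d + j * g" using g by (simp add: field_simps)
  from *[OF this] show ?thesis by blast
qed

text \<open>For a positive proportion of the \<open>y\<close>, the words related to \<open>y\<close>
  are dense enough to contain a line. There are finitely many lines, so one of them serves a
  proportion \<theta> of the \<open>y\<close> that is independent of \<open>Y\<close> and
  \<open>S\<close>.\<close>

lemma DHJ_average:
  assumes "DHJ k (d / 2) n" "0 < d" "0 < k"
  shows "\<exists>\<theta>>0::real. \<forall>Y S. finite (Y :: 'b set) \<longrightarrow> Y \<noteq> {} \<longrightarrow>
    d * k ^ n * card Y \<le> (\<Sum>y\<in>Y. real (card {w\<in>words k n. S w y})) \<longrightarrow>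
    (\<exists>t\<in>templates k 1 n. \<theta> * card Y \<le> card {y\<in>Y. \<forall>c<k. S (inst t [c]) y})"
proof -
  let ?T = "templates k 1 n"
  \<comment> \<open>The proportion \<open>d / 2\<close> of good \<open>y\<close>, divided by the
    pigeonhole loss over the lines. The 1 keeps the quotient positive before any line is known to
    exist.\<close>
  define th where "th = d / 2 / (1 + card ?T)"
  have "0 < th" using assms(2) by (simp add: th_def add_pos_nonneg)
  moreover have "\<exists>t\<in>?T. th * card Y \<le> card {y\<in>Y. \<forall>c<k. S (inst t [c]) y}"
    if Y: "finite Y" "Y \<noteq> {}"
      and avg: "d * k ^ n * card Y \<le> (\<Sum>y\<in>Y. real (card {w\<in>words k n. S w y}))"
    for Y :: "'b set" and S
  proof -
  define Z where "Z = {y\<in>Y. d / 2 * card (words k n) \<le> card {w\<in>words k n. S w y}}"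
  have "words k n \<noteq> {}" using assms(3) by (rule words_nonempty)
  then have "d / 2 * card Y \<le> card Z"
    unfolding Z_def using Y(1) assms(2) avg by (intro average_fibre) (auto simp: mult_ac)
  have line: "\<exists>t\<in>?T. \<forall>c<k. S (inst t [c]) y" if "y \<in> Z" for y
    using assms(1)[unfolded DHJ_def, rule_format, of "{w\<in>words k n. S w y}"] that
    by (auto simp: Z_def has_line_def)
  have "finite Z" using Y(1) by (simp add: Z_def)
  have "Z \<noteq> {}" using \<open>d / 2 * card Y \<le> card Z\<close> Y assms(2) by (auto simp: mult_le_0_iff)
  then have "?T \<noteq> {}" using line by blast
  obtain t where t: "t \<in> ?T" "real (card Z) \<le> card ?T * card {y\<in>Z. \<forall>c<k. S (inst t [c]) y}"
    using pigeonhole_choice[where Q = "\<lambda>t y. \<forall>c<k. S (inst t [c]) y", OF _ \<open>finite Z\<close> line \<open>?T \<noteq> {}\<close>] by auto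
  show "\<exists>t\<in>?T. th * card Y \<le> card {y\<in>Y. \<forall>c<k. S (inst t [c]) y}"
  proof (rule bexI[OF _ t(1)])
    have "d / 2 * card Y \<le> card ?T * card {y\<in>Z. \<forall>c<k. S (inst t [c]) y}"
      using t(2) \<open>d / 2 * card Y \<le> card Z\<close> by linarith
    also have "\<dots> \<le> (1 + card ?T) * card {y\<in>Y. \<forall>c<k. S (inst t [c]) y}"
      using Y(1) by (intro of_nat_mono mult_mono card_mono) (auto simp: Z_def)
    finally show "th * card Y \<le> card {y\<in>Y. \<forall>c<k. S (inst t [c]) y}"
      by (simp add: th_def field_simps)
  qed
  qed
  ultimately show ?thesis by blast
qed

text \<open>Induction on the dimension: for some line in the first \<open>a\<close> letters, a
  positive proportion of the tails puts all its points into the set, and these tails contain a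
  subspace of one dimension less.\<close>

lemma DHJ_subspace:
  assumes "\<And>d. 0 < d \<Longrightarrow> \<exists>n. DHJ k d n" "0 < d" "0 < k"
  shows "\<exists>n. \<forall>A\<subseteq>words k n. d * real k ^ n \<le> card A \<longrightarrow>
    (\<exists>t\<in>templates k q n. \<forall>w\<in>words k q. inst t w \<in> A)"
  using assms(2)
proof (induction q arbitrary: d)
  case 0
  have "[] \<in> A" if "A \<subseteq> words k 0" "d * real k ^ 0 \<le> card A" for A
    using that 0 by (cases "A = {}") auto
  then show ?case
    by (intro exI[of _ 0] allI impI bexI[of _ "[]"]) (auto simp: templates_def)
next
  case (Suc q)
  obtain a where "DHJ k (d / 2) a" using assms(1)[of "d / 2"] Suc.prems by auto
  from DHJ_average[OF this Suc.prems assms(3)] obtain \<theta> :: real where \<theta>: "0 < \<theta>"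
    "\<And>(Y :: nat list set) S. \<lbrakk>finite Y; Y \<noteq> {};
      d * k ^ a * card Y \<le> (\<Sum>y\<in>Y. real (card {w\<in>words k a. S w y}))\<rbrakk> \<Longrightarrow>
      \<exists>t\<in>templates k 1 a. \<theta> * card Y \<le> card {y\<in>Y. \<forall>c<k. S (inst t [c]) y}"
    by blast
  obtain b where b: "\<And>A. \<lbrakk>A \<subseteq> words k b; \<theta> * real k ^ b \<le> card A\<rbrakk> \<Longrightarrow>
    \<exists>t\<in>templates k q b. \<forall>w\<in>words k q. inst t w \<in> A"
    using Suc.IH[OF \<theta>(1)] by blast
  show ?case
  proof (intro exI[of _ "a + b"] allI impI)
    fix A assume A: "A \<subseteq> words k (a + b)" "d * real k ^ (a + b) \<le> card A"
    have "{w \<in> words k (a + b). w \<in> A} = A" using A by auto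
    then have "real (card A) = (\<Sum>y\<in>words k b. real (card {w\<in>words k a. w @ y \<in> A}))"
      using card_words_append'[of k a b "\<lambda>w. w \<in> A"] by simp
    moreover have "words k b \<noteq> {}" using assms(3) by (rule words_nonempty)
    ultimately obtain t where t: "t\<in>templates k 1 a"
      "\<theta> * real k ^ b \<le> card {y\<in>words k b. \<forall>c<k. inst t [c] @ y \<in> A}"
      using \<theta>(2)[of "words k b" "\<lambda>w y. w @ y \<in> A"] A(2) by (auto simp: power_add mult_ac)
    obtain s where s: "s \<in> templates k q b"
      "\<And>w. w\<in>words k q \<Longrightarrow> inst s w \<in> {y\<in>words k b. \<forall>c<k. inst t [c] @ y \<in> A}"
      using b[OF _ t(2)] by blast
    show "\<exists>t\<in>templates k (Suc q) (a + b). \<forall>w\<in>words k (Suc q). inst t w \<in> A"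
    proof (intro bexI ballI)
      show "tjoin 1 t s \<in> templates k (Suc q) (a + b)" using tjoin_in_templates[OF t(1) s(1)] by simp
      fix w assume "w \<in> words k (Suc q)"
      then obtain c v where "w = c # v" "c < k" "v \<in> words k q" by (cases w) (auto simp: words_def)
      then show "inst (tjoin 1 t s) w \<in> A" using inst_tjoin[OF t(1), of "[c]" s v] s(2) by auto
    qed
  qed
qed

section \<open>Lines with all extensions good\<close>

text \<open>A word over \<open>k + 1\<close> letters in which the letter \<open>k\<close> occurs encodes a line over \<open>k\<close> letters.\<close>

definition line_of :: "nat \<Rightarrow> nat list \<Rightarrow> (nat + nat) list" where
  "line_of k w = map (\<lambda>c. if c < k then Inl c else Inr 0) w"

lemma line_of_map: "line_of k (map f t) = map (\<lambda>a. if f a < k then Inl (f a) else Inr 0) t"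
  by (simp add: line_of_def)

text \<open>Turns a subspace over \<open>k + 1\<close> letters into one over \<open>k\<close>
  letters whose variable 0 replaces the letter \<open>k\<close>. The leading variable guarantees
  that it occurs. Lines encoded by points of the old subspace, with a wildcard put in front, lie in
  the new one (\<open>tinst_wild\<close>).\<close>

definition wild :: "nat \<Rightarrow> (nat + nat) list \<Rightarrow> (nat + nat) list" where
  "wild k t = Inr 0 # map (case_sum (\<lambda>c. if c < k then Inl c else Inr 0) (\<lambda>j. Inr (Suc j))) t"

lemma wild_in_templates:
  assumes "t \<in> templates (Suc k) m n"
  shows "wild k t \<in> templates k (Suc m) (Suc n)"
proof -
  let ?f = "case_sum (\<lambda>c. if c < k then Inl c else Inr 0) (\<lambda>j. Inr (Suc j)) :: nat + nat \<Rightarrow> nat + nat"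
  have "?f x \<in> Inl ` {..<k} \<union> Inr ` {..<Suc m}" if "x \<in> set t" for x
  proof (cases x)
    case (Inl c)
    then show ?thesis by auto
  next
    case (Inr j)
    then show ?thesis using that assms by (auto simp: templates_def)
  qed
  moreover have "Inr j \<in> set (wild k t)" if "j < Suc m" for j
  proof (cases j)
    case 0
    then show ?thesis by (simp add: wild_def)
  next
    case (Suc j')
    then have "Inr j' \<in> set t" using that assms by (auto simp: templates_def)
    then have "?f (Inr j') \<in> set (wild k t)" unfolding wild_def list.set set_map by blast
    then show ?thesis using Suc by simp
  qed
  ultimately show ?thesis using assms by (auto simp: templates_def wild_def)
qed

lemma tinst_wild:
  assumes "t \<in> templates (Suc k) m n" "length x = m"
  shows "tinst (wild k t) (Inr 0 # line_of k x) = Inr 0 # line_of k (inst t x)"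
proof -
  have "case_sum Inl (\<lambda>j. (Inr 0 # line_of k x) ! j)
      (case_sum (\<lambda>c. if c < k then Inl c else Inr 0) (\<lambda>j. Inr (Suc j)) a)
    = (\<lambda>c. if c < k then Inl c else Inr 0) (case_sum id (\<lambda>j. x ! j) a)" if "a \<in> set t" for a
  proof (cases a)
    case (Inl c)
    then show ?thesis by simp
  next
    case (Inr j)
    then have "j < m" using assms(1) that by (auto simp: templates_def)
    then show ?thesis using Inr assms(2) by (simp add: line_of_def)
  qed
  then show ?thesis by (simp add: tinst_def wild_def line_of_map inst_def)
qed

lemma constant_templateE:
  fixes l :: "(nat + nat) list"
  assumes "set l \<subseteq> Inl ` {..<k}"
  obtains u where "l = map Inl u" "u \<in> words k (length l)"
proof
  let ?u = "map (case_sum id id) l"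
  show "l = map Inl ?u"
    unfolding map_map by (rule map_idI[symmetric]) (use assms in auto)
  show "?u \<in> words k (length l)" using assms by (auto simp: words_def)
qed

lemma line_of_wordE:
  fixes l :: "(nat + nat) list"
  assumes "set l \<subseteq> Inl ` {..<k} \<union> Inr ` {..<1}"
  obtains x where "l = line_of k x" "x \<in> words (Suc k) (length l)"
proof
  let ?x = "map (case_sum id (\<lambda>_. k)) l"
  have *: "case_sum id (\<lambda>_. k) a \<le> k \<and>
      (if case_sum id (\<lambda>_. k) a < k then Inl (case_sum id (\<lambda>_. k) a) else Inr 0) = a" if "a \<in> set l" for a
    using assms that by (cases a) auto
  show "l = line_of k ?x"
    unfolding line_of_def map_map by (rule map_idI[symmetric]) (use * in auto)
  show "?x \<in> words (Suc k) (length l)" using * by (auto simp: words_def less_Suc_eq_le)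
qed

text \<open>A weak form of the Graham--Rothschild theorem for lines.  Unless the first alternative holds,
  the Hales--Jewett theorem over \<open>k + 1\<close> letters produces subspaces in which all lines with a wildcard
  among the first \<open>j\<close> coordinates are bad.\<close>

lemma good_lines_step:
  assumes "0 < k"
  shows "\<exists>M. \<forall>G. (\<exists>U\<in>templates k (Suc m) M. \<forall>x\<in>words (Suc k) m. G (tinst U (Inr 0 # line_of k x))) \<or>
    (\<exists>W\<in>templates k (j + q) M. \<forall>l\<in>templates k 1 (j + q). Inr 0 \<in> set (take j l) \<longrightarrow> \<not> G (tinst W l))"
proof (induction j arbitrary: q)
  case 0
  show ?case by (intro exI[of _ q] allI disjI2 bexI[of _ "id_template q"]) auto
next
  case (Suc j)
  obtain Q where Q: "\<And>\<kappa>. (\<forall>w\<in>words (Suc k) Q. \<kappa> w < (2::nat) ^ k ^ j) \<Longrightarrow>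
    \<exists>t\<in>templates (Suc k) (q + m) Q.
      \<forall>v\<in>words (Suc k) (q + m). \<forall>w\<in>words (Suc k) (q + m). \<kappa> (inst t v) = \<kappa> (inst t w)"
    using Hales_Jewett[of "Suc k" "2 ^ k ^ j" "q + m"] by auto
  obtain M where M: "\<And>G. (\<exists>U\<in>templates k (Suc m) M. \<forall>x\<in>words (Suc k) m. G (tinst U (Inr 0 # line_of k x))) \<or>
    (\<exists>W\<in>templates k (j + Suc Q) M. \<forall>l\<in>templates k 1 (j + Suc Q). Inr 0 \<in> set (take j l) \<longrightarrow> \<not> G (tinst W l))"
    using Suc.IH[of "Suc Q"] by blast
  have "(\<exists>U\<in>templates k (Suc m) M. \<forall>x\<in>words (Suc k) m. G (tinst U (Inr 0 # line_of k x))) \<or>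
    (\<exists>W\<in>templates k (Suc j + q) M. \<forall>l\<in>templates k 1 (Suc j + q). Inr 0 \<in> set (take (Suc j) l) \<longrightarrow> \<not> G (tinst W l))"
    (is "?U \<or> ?W") for G
  proof (rule disjCI)
    assume "\<not> ?W"
    show ?U
    proof (cases ?U)
      case False
      then obtain W where W: "W \<in> templates k (j + Suc Q) M"
        "\<And>l. l\<in>templates k 1 (j + Suc Q) \<Longrightarrow> Inr 0 \<in> set (take j l) \<Longrightarrow> \<not> G (tinst W l)"
        using M[of G] by blast
      \<comment> \<open>Colours a word by the set of constant prefixes of length \<open>j\<close>
        that make the line with first wildcard at position \<open>j\<close> good. There are
        \<open>2 ^ k ^ j\<close> possible colours.\<close>
      define \<kappa> where "\<kappa> v = {u\<in>words k j. G (tinst W (map Inl u @ Inr 0 # line_of k v))}" for v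
      obtain \<kappa>' :: "nat list \<Rightarrow> nat" where \<kappa>': "\<forall>w\<in>words (Suc k) Q. \<kappa>' w < 2 ^ k ^ j"
        "\<And>w w'. w \<in> words (Suc k) Q \<Longrightarrow> w' \<in> words (Suc k) Q \<Longrightarrow> \<kappa>' w = \<kappa>' w' \<longleftrightarrow> \<kappa> w = \<kappa> w'"
        by (rule colour_nat[of "Pow (words k j)" "2 ^ k ^ j" "words (Suc k) Q" \<kappa>])
           (auto simp: card_Pow \<kappa>_def)
      obtain T where T: "T \<in> templates (Suc k) (q + m) Q"
        "\<forall>v\<in>words (Suc k) (q + m). \<forall>w\<in>words (Suc k) (q + m). \<kappa>' (inst T v) = \<kappa>' (inst T w)"
        using Q[OF \<kappa>'(1)] by blast
      define E where "E = \<kappa> (inst T (replicate (q + m) 0))"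
      have E: "\<kappa> (inst T v) = E" if "v \<in> words (Suc k) (q + m)" for v
      proof -
        have "replicate (q + m) 0 \<in> words (Suc k) (q + m)" by (auto simp: words_def)
        then show ?thesis using T that \<kappa>'(2) inst_in_words[OF T(1)] unfolding E_def by blast
      qed
      have sub: "\<exists>T'\<in>templates (Suc k) a Q. \<forall>x\<in>words (Suc k) a. \<kappa> (inst T' x) = E"
        if "a + b = q + m" for a b
      proof (intro bexI ballI)
        have r: "freeze a b \<in> templates (Suc k) a (q + m)"
          using freeze_in_templates[of "Suc k" a b] that by simp
        show "tinst T (freeze a b) \<in> templates (Suc k) a Q" using T(1) r by (rule tinst_in_templates)
        show "\<kappa> (inst (tinst T (freeze a b)) x) = E" if "x \<in> words (Suc k) a" for x
          unfolding inst_tinst[OF T(1) length_template[OF r]] by (intro E inst_in_words[OF r] that)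
      qed
      show ?thesis
      \<comment> \<open>A prefix in the constant colour \<open>E\<close> makes all these lines good,
        which gives the first alternative. If \<open>E\<close> is empty, no line with first wildcard
        at position \<open>j\<close> is good, and badness extends from \<open>j\<close> to
        \<open>j + 1\<close> coordinates.\<close>
      proof (cases "E = {}")
        case False
        then obtain u where u: "u \<in> E" by blast
        then have uw: "u \<in> words k j" by (auto simp: E_def \<kappa>_def)
        obtain T' where T': "T' \<in> templates (Suc k) m Q" "\<And>x. x\<in>words (Suc k) m \<Longrightarrow> \<kappa> (inst T' x) = E"
          using sub[of m q] by (auto simp: add.commute)
        have t: "map Inl u @ wild k T' \<in> templates k (Suc m) (j + Suc Q)"
          using uw T'(1) by (intro prefix_in_templates wild_in_templates)
        show ?thesis
        proof (intro bexI ballI)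
          show "tinst W (map Inl u @ wild k T') \<in> templates k (Suc m) M"
            using W(1) t by (rule tinst_in_templates)
          fix x assume x: "x \<in> words (Suc k) m"
          have "u \<in> \<kappa> (inst T' x)" using T'(2)[OF x] u by simp
          then show "G (tinst (tinst W (map Inl u @ wild k T')) (Inr 0 # line_of k x))"
            unfolding tinst_tinst[OF W(1) length_template[OF t]] tinst_append tinst_map_Inl
              tinst_wild[OF T'(1) length_word[OF x]] \<kappa>_def by simp
        qed
      next
        case True
        obtain T' where T': "T' \<in> templates (Suc k) q Q" "\<And>x. x\<in>words (Suc k) q \<Longrightarrow> \<kappa> (inst T' x) = {}"
          using sub[of q m] True by auto
        define V where "V = tjoin j (id_template j) (wild k T')"
        have V: "V \<in> templates k (j + Suc q) (j + Suc Q)"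
          unfolding V_def by (intro tjoin_in_templates id_template_in_templates wild_in_templates T'(1))
        have "?W"
        proof (intro bexI ballI impI)
          show "tinst W V \<in> templates k (Suc j + q) M"
            using tinst_in_templates[OF W(1) V] by simp
          fix l assume "l \<in> templates k 1 (Suc j + q)" "Inr 0 \<in> set (take (Suc j) l)"
          then have l: "l \<in> templates k 1 (j + Suc q)" "Inr 0 \<in> set (take (Suc j) l)" by simp_all
          define l1 l2 where "l1 = take j l" and "l2 = drop j l"
          have l12: "l = l1 @ l2" "length l1 = j" "length l2 = Suc q"
            using l(1) by (auto simp: l1_def l2_def templates_def)
          have Vl: "tinst V l = l1 @ tinst (wild k T') l2"
            using l12 by (simp add: V_def tinst_tjoin[OF id_template_in_templates])
          have "\<not> G (tinst W (tinst V l))"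
          proof (cases "Inr 0 \<in> set l1")
            case True
            then show ?thesis using Vl l12 by (intro W(2) tinst_in_templates[OF V l(1)]) simp
          next
            case False
            have "set l1 \<subseteq> Inl ` {..<k}"
              using l(1) False l12(1) by (auto simp: templates_def)
            then obtain u where u: "l1 = map Inl u" "u \<in> words k j"
              using l12(2) constant_templateE by metis
            obtain a l3 where "l2 = a # l3" "length l3 = q" using l12(3) by (cases l2) auto
            moreover from this have "a = Inr 0"
              using l(2) l12 False by (auto simp: take_Cons')
            ultimately have l3: "l2 = Inr 0 # l3" "length l3 = q" by simp_all
            have "set l3 \<subseteq> Inl ` {..<k} \<union> Inr ` {..<1}"
              using l(1) l12(1) l3(1) by (auto simp: templates_def)
            then obtain x where x: "l3 = line_of k x" "x \<in> words (Suc k) q"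
              using line_of_wordE l3(2) by metis
            have "tinst V l = map Inl u @ Inr 0 # line_of k (inst T' x)"
              unfolding Vl u l3 x tinst_wild[OF T'(1) length_word[OF x(2)]] ..
            moreover have "u \<notin> \<kappa> (inst T' x)" using T'(2)[OF x(2)] by simp
            ultimately show ?thesis using u(2) by (simp add: \<kappa>_def)
          qed
          then show "\<not> G (tinst (tinst W V) l)"
            by (simp add: tinst_tinst[OF W(1) length_template[OF V]])
        qed
        then show ?thesis using \<open>\<not> ?W\<close> by simp
      qed
    qed
  qed
  then show ?case by blast
qed

text \<open>Every line has a wildcard among its \<open>a\<close> letters, so for
  \<open>j = a\<close> and \<open>q = 0\<close> the second alternative of
  \<open>good_lines_step\<close> is an \<open>a\<close>-dimensional subspace without good
  lines.\<close>

lemma good_lines: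
  assumes "0 < k"
  shows "\<exists>M. \<forall>G. (\<forall>W\<in>templates k a M. \<exists>l\<in>templates k 1 a. G (tinst W l)) \<longrightarrow>
    (\<exists>U\<in>templates k (Suc m) M. \<forall>x\<in>words (Suc k) m. G (tinst U (Inr 0 # line_of k x)))"
proof -
  obtain M where M: "\<And>G. (\<exists>U\<in>templates k (Suc m) M. \<forall>x\<in>words (Suc k) m. G (tinst U (Inr 0 # line_of k x))) \<or>
    (\<exists>W\<in>templates k (a + 0) M. \<forall>l\<in>templates k 1 (a + 0). Inr 0 \<in> set (take a l) \<longrightarrow> \<not> G (tinst W l))"
    using good_lines_step[OF assms, where j = a and q = 0] by blast
  have "Inr 0 \<in> set (take a l)" if "l \<in> templates k 1 a" for l
    using that by (auto simp: templates_def)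
  then show ?thesis using M by (metis add_0_right)
qed

section \<open>Partitioning insensitive sets into subspaces\<close>

inductive_set subspace_unions :: "nat \<Rightarrow> nat \<Rightarrow> nat \<Rightarrow> nat list set set" for k q n where
  empty: "{} \<in> subspace_unions k q n"
| add: "\<lbrakk>E \<in> subspace_unions k q n; t \<in> templates k q n; inst t ` words k q \<inter> E = {}\<rbrakk>
    \<Longrightarrow> inst t ` words k q \<union> E \<in> subspace_unions k q n"

lemma subspace_unions_subset: "E \<in> subspace_unions k q n \<Longrightarrow> E \<subseteq> words k n"
  by (induction rule: subspace_unions.induct) (auto intro: inst_in_words)

lemma finite_subspace_unions: "E \<in> subspace_unions k q n \<Longrightarrow> finite E"
  using subspace_unions_subset finite_words finite_subset by metis

lemma subspace_unions_single: "t \<in> templates k q n \<Longrightarrow> inst t ` words k q \<in> subspace_unions k q n"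
  using subspace_unions.add[OF subspace_unions.empty, of t k q n] by simp

lemma subspace_unions_Un:
  assumes "E \<in> subspace_unions k q n" "F \<in> subspace_unions k q n" "E \<inter> F = {}"
  shows "E \<union> F \<in> subspace_unions k q n"
  using assms(1,3)
proof (induction rule: subspace_unions.induct)
  case empty
  then show ?case using assms(2) by simp
next
  case (add E t)
  then show ?case unfolding Un_assoc by (intro subspace_unions.add) auto
qed

lemma subspace_unions_UN:
  assumes "finite I" "\<And>i. i \<in> I \<Longrightarrow> E i \<in> subspace_unions k q n"
    and "\<And>i j. i \<in> I \<Longrightarrow> j \<in> I \<Longrightarrow> i \<noteq> j \<Longrightarrow> E i \<inter> E j = {}"
  shows "(\<Union>i\<in>I. E i) \<in> subspace_unions k q n"
  using assms
proof (induction I rule: finite_induct)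
  case empty
  then show ?case by (simp add: subspace_unions.empty)
next
  case (insert i I)
  have "(\<Union>i\<in>I. E i) \<in> subspace_unions k q n" using insert by blast
  moreover have "E i \<inter> (\<Union>i\<in>I. E i) = {}" using insert.prems(2)[of i] insert.hyps by blast
  ultimately show ?case using subspace_unions_Un insert.prems(1) by simp
qed

lemma subspace_unions_image:
  assumes "E \<in> subspace_unions k q m" "t \<in> templates k m n"
  shows "inst t ` E \<in> subspace_unions k q n"
  using assms(1)
proof (induction rule: subspace_unions.induct)
  case empty
  then show ?case by (simp add: subspace_unions.empty)
next
  case (add E s)
  have s: "s \<in> templates k q m" by fact
  have eq: "inst t ` inst s ` words k q = inst (tinst t s) ` words k q"
    using inst_tinst[OF assms(2) length_template[OF s]] by (simp add: image_image)
  have "inst s ` words k q \<subseteq> words k m" "E \<subseteq> words k m"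
    using inst_in_words[OF s] subspace_unions_subset[OF add.hyps(1)] by auto
  then have "inst t ` inst s ` words k q \<inter> inst t ` E = {}"
    using add.hyps(3) inj_on_image_Int[OF inj_on_inst[OF assms(2)]] by (metis image_empty)
  then show ?case unfolding image_Un eq
    by (intro subspace_unions.add add.IH tinst_in_templates[OF assms(2) s])
qed

text \<open>Averaging: were \<open>B\<close> sparser than \<open>d\<close> on every subspace, it
  would be sparser on each nonempty disjoint union of them.\<close>

lemma dense_part:
  fixes d :: real
  assumes "E \<in> subspace_unions k q n" "E \<noteq> {}" "d * card E \<le> card (B \<inter> E)"
  shows "\<exists>t\<in>templates k q n. d * real k ^ q \<le> card {w\<in>words k q. inst t w \<in> B}"
proof (rule ccontr)
  assume "\<not> ?thesis"
  then have sparse: "card {w\<in>words k q. inst t w \<in> B} < d * real k ^ q" if "t \<in> templates k q n" for t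
    using that by auto
  have "card (B \<inter> E) \<le> d * card E \<and> (E \<noteq> {} \<longrightarrow> card (B \<inter> E) < d * card E)"
    using assms(1)
  proof (induction rule: subspace_unions.induct)
    case empty
    then show ?case by simp
  next
    case (add E t)
    let ?V = "inst t ` words k q"
    have inj: "inj_on (inst t) (words k q)" using add.hyps(2) by (rule inj_on_inst)
    have "B \<inter> ?V = inst t ` {w\<in>words k q. inst t w \<in> B}" by auto
    then have "card (B \<inter> ?V) = card {w\<in>words k q. inst t w \<in> B}"
      using inj by (simp add: card_image inj_on_subset)
    then have V: "card (B \<inter> ?V) < d * card ?V"
      using sparse[OF add.hyps(2)] inj by (simp add: card_image)
    have fin: "finite E" using add.hyps(1) by (rule finite_subspace_unions)
    have "card (B \<inter> (?V \<union> E)) = card (B \<inter> ?V) + card (B \<inter> E)"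
      unfolding Int_Un_distrib using fin add.hyps(3) by (intro card_Un_disjoint) auto
    moreover have "card (?V \<union> E) = card ?V + card E"
      using fin add.hyps(3) by (intro card_Un_disjoint) auto
    ultimately show ?case using V add.IH by (simp add: algebra_simps)
  qed
  then show False using assms(2,3) by simp
qed

section \<open>Insensitive sets\<close>

definition insensitive :: "nat \<Rightarrow> nat \<Rightarrow> nat \<Rightarrow> nat list set \<Rightarrow> bool" where
  "insensitive i k n D \<longleftrightarrow> (\<forall>w\<in>words (Suc k) n. w \<in> D \<longleftrightarrow> merge i k w \<in> D)"

text \<open>Unlike in \<open>merge_inst\<close>, \<open>t\<close> may fix the letter
  \<open>k\<close>, hence the outer merging on both sides.\<close>

lemma merge_inst_merge:
  assumes "t \<in> templates k' m n" "length w = m" "i < k"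
  shows "merge i k (inst t (merge i k w)) = merge i k (inst t w)"
  using assms by (auto simp: templates_def inst_def merge_def)

lemma insensitive_inst:
  assumes "insensitive i k n D" "t \<in> templates (Suc k) m n" "i < k"
  shows "insensitive i k m {w. inst t w \<in> D}"
  unfolding insensitive_def
proof (intro ballI)
  fix w assume w: "w \<in> words (Suc k) m"
  have "inst t w \<in> words (Suc k) n" "inst t (merge i k w) \<in> words (Suc k) n"
    using w assms(2,3) by (auto intro: inst_in_words merge_in_words_Suc)
  then show "w \<in> {w. inst t w \<in> D} \<longleftrightarrow> merge i k w \<in> {w. inst t w \<in> D}"
    using assms(1) merge_inst_merge[OF assms(2) length_word[OF w] assms(3)]
    unfolding insensitive_def by (metis mem_Collect_eq)
qed

text \<open>The theorem for \<open>k\<close> letters gives a subspace whose words with parameters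
  below \<open>k\<close> lie in \<open>D\<close>. Insensitivity extends this to parameters
  containing \<open>k\<close>.\<close>

lemma dense_insensitive_subspace:
  assumes "\<And>d. 0 < d \<Longrightarrow> \<exists>n. DHJ k d n" "0 < d" "i < k"
  shows "\<exists>n. \<forall>D\<subseteq>words (Suc k) n. insensitive i k n D \<longrightarrow> d * real (Suc k) ^ n \<le> card D \<longrightarrow>
    (\<exists>t\<in>templates (Suc k) q n. inst t ` words (Suc k) q \<subseteq> D)"
proof -
  have k: "0 < k" using assms(3) by simp
  have d2: "0 < d / 2" using assms(2) by simp
  obtain m where m: "\<And>A. \<lbrakk>A\<subseteq>words k m; d / 2 * real k ^ m \<le> card A\<rbrakk> \<Longrightarrow>
      \<exists>t\<in>templates k q m. \<forall>w\<in>words k q. inst t w \<in> A"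
    using DHJ_subspace[OF assms(1) d2 k] by blast
  obtain n where n: "\<And>D. \<lbrakk>D\<subseteq>words (Suc k) n; d * real (Suc k) ^ n \<le> card D\<rbrakk> \<Longrightarrow>
    \<exists>p u r. n = p + m + r \<and> u \<in> words (Suc k) p \<and>
      (\<forall>t\<in>words (Suc k) m. (d - d / 2) * real (Suc k) ^ r \<le> card {y\<in>words (Suc k) r. u @ t @ y \<in> D})"
    using dense_fibres[OF d2, of "Suc k" d m] by blast
  have "\<exists>t\<in>templates (Suc k) q n. inst t ` words (Suc k) q \<subseteq> D"
    if D: "D\<subseteq>words (Suc k) n" "insensitive i k n D" "d * real (Suc k) ^ n \<le> card D" for D
  proof -
    obtain p u r where u: "n = p + m + r" "u \<in> words (Suc k) p"
      "\<And>t. t\<in>words (Suc k) m \<Longrightarrow> d / 2 * real (Suc k) ^ r \<le> card {y\<in>words (Suc k) r. u @ t @ y \<in> D}"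
      using n[OF D(1,3)] by auto
    have sub: "t \<in> words (Suc k) a" if "t \<in> words k a" for t a using that words_mono[of k "Suc k" a] by auto
    \<comment> \<open>All fibres over the block are dense, in particular those over the words
      avoiding \<open>k\<close>, although such words may be rare. Hence some common tail
      \<open>y\<close> keeps many of them.\<close>
    have "\<exists>y\<in>words (Suc k) r. d / 2 * real k ^ m \<le> card {t\<in>words k m. u @ t @ y \<in> D}"
    proof (rule ccontr)
      assume "\<not> ?thesis"
      then have "(\<Sum>y\<in>words (Suc k) r. real (card {t\<in>words k m. u @ t @ y \<in> D}))
          < (\<Sum>y\<in>words (Suc k) r. d / 2 * real k ^ m)"
        using words_nonempty[of "Suc k" r] by (intro sum_strict_mono) auto
      also have "\<dots> = (\<Sum>t\<in>words k m. d / 2 * real (Suc k) ^ r)" by simp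
      also have "\<dots> \<le> (\<Sum>t\<in>words k m. real (card {y\<in>words (Suc k) r. u @ t @ y \<in> D}))"
        using u(3) sub by (intro sum_mono) auto
      also have "\<dots> = (\<Sum>y\<in>words (Suc k) r. real (card {t\<in>words k m. u @ t @ y \<in> D}))"
        unfolding of_nat_sum[symmetric] by (subst sum_card_swap) simp_all
      finally show False by simp
    qed
    then obtain y where y: "y \<in> words (Suc k) r"
      "d / 2 * real k ^ m \<le> card {t\<in>words k m. u @ t @ y \<in> D}" by blast
    obtain s where s: "s \<in> templates k q m" "\<forall>w\<in>words k q. u @ inst s w @ y \<in> D"
      using m[OF _ y(2)] by auto
    have s': "s \<in> templates (Suc k) q m" using s(1) templates_mono[of k "Suc k"] by auto
    define T where "T = map Inl u @ s @ map Inl y"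
    have T: "T \<in> templates (Suc k) q n"
      using prefix_in_templates[OF u(2) suffix_in_templates[OF y(1) s']] u(1)
      by (simp add: T_def add.assoc)
    have "inst T w \<in> D" if w: "w \<in> words (Suc k) q" for w
    proof -
      \<comment> \<open>\<open>u\<close> and \<open>y\<close> may contain \<open>k\<close>, so
        insensitivity is used once to merge the whole word and once to undo it.\<close>
      have "u @ inst s (merge i k w) @ y \<in> D"
        using s(2) merge_in_words[OF assms(3) w] by blast
      then have "merge i k (inst T (merge i k w)) \<in> D"
        using D(1,2) unfolding insensitive_def by (auto simp: T_def)
      then have "merge i k (inst T w) \<in> D"
        using merge_inst_merge[OF T length_word[OF w] assms(3)] by simp
      then show ?thesis using D(2) inst_in_words[OF T w] unfolding insensitive_def by blast
    qed
    with T show ?thesis by blast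
  qed
  then show ?thesis by blast
qed

lemma card_Diff_fibres:
  assumes "D \<subseteq> words k (a + b)"
  shows "card (D - E) = (\<Sum>x\<in>words k a. card ({y\<in>words k b. x @ y \<in> D} - {y. x @ y \<in> E}))"
proof -
  have "{y\<in>words k b. x @ y \<in> D} - {y. x @ y \<in> E} = {y\<in>words k b. x @ y \<in> D - E}" for x by auto
  then show ?thesis using card_fibres_append[of "D - E" k a b] assms by (simp add: subset_iff)
qed

text \<open>Greedy exhaustion. In each round every dense fibre in the next \<open>a\<close> letters
  loses a \<open>q\<close>-dimensional subspace. The excess over density \<open>e / 2\<close>
  becomes at most \<open>c\<close> times the previous one, and the remainder is still insensitive in
  the later letters.\<close>

lemma partition_insensitive:
  assumes "\<And>d. 0 < d \<Longrightarrow> \<exists>n. DHJ k d n" "0 < e" "i < k"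
  shows "\<exists>n. \<forall>D\<subseteq>words (Suc k) n. insensitive i k n D \<longrightarrow>
    (\<exists>E\<in>subspace_unions (Suc k) q n. E \<subseteq> D \<and> card (D - E) \<le> e * real (Suc k) ^ n)"
proof -
  let ?K = "Suc k"
  have e2: "0 < e / 2" using assms(2) by simp
  obtain a where a: "\<And>D. \<lbrakk>D\<subseteq>words ?K a; insensitive i k a D; e / 2 * real ?K ^ a \<le> card D\<rbrakk> \<Longrightarrow>
    \<exists>t\<in>templates ?K q a. inst t ` words ?K q \<subseteq> D"
    using dense_insensitive_subspace[OF assms(1) e2 assms(3), of q] by blast
  \<comment> \<open>A dense fibre has at most \<open>?K ^ a\<close> words and loses at least one of
    them.\<close>
  define c where "c = 1 - 1 / real ?K ^ a"
  have c: "0 \<le> c" "c < 1" unfolding c_def by (simp_all add: divide_le_eq_1 one_le_power del: of_nat_Suc)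
  have claim: "\<exists>E\<in>subspace_unions ?K q (a * j). E \<subseteq> D \<and>
      card (D - E) \<le> e / 2 * real ?K ^ (a * j) + c ^ j * (card D - e / 2 * real ?K ^ (a * j))"
    if "D \<subseteq> words ?K (a * j)" "insensitive i k (a * j) D" for j D
    using that
  proof (induction j arbitrary: D)
    case 0
    show ?case by (intro bexI[of _ "{}"]) (auto intro: subspace_unions.empty)
  next
    case (Suc j)
    let ?b = "a * j"
    have D: "D \<subseteq> words ?K (a + ?b)" "insensitive i k (a + ?b) D" using Suc.prems by simp_all
    have Dm: "x @ y \<in> D \<longleftrightarrow> merge i k x @ merge i k y \<in> D"
      if "x \<in> words ?K a" "y \<in> words ?K ?b" for x y
      using D(2) append_in_words[OF that] unfolding insensitive_def by simp
    define F where "F y = {x\<in>words ?K a. x @ y \<in> D}" for y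
    have F_merge: "F (merge i k y) = F y" if "y \<in> words ?K ?b" for y
    proof -
      have "merge i k y \<in> words ?K ?b" using merge_in_words_Suc[OF assms(3) that] .
      then show ?thesis using Dm that assms(3) by (auto simp: F_def)
    qed
    have F_ins: "insensitive i k a (F y)" if "y \<in> words ?K ?b" for y
      unfolding insensitive_def
    proof
      fix x assume x: "x \<in> words ?K a"
      have "merge i k x \<in> words ?K a" using merge_in_words_Suc[OF assms(3) x] .
      then show "x \<in> F y \<longleftrightarrow> merge i k x \<in> F y" using Dm that assms(3) x by (auto simp: F_def)
    qed
    \<comment> \<open>The subspace is chosen as a function of the fibre, not of \<open>y\<close>. As
      \<open>y\<close> and \<open>merge i k y\<close> have the same fibre, the same subspace is
      removed over both, and the remainder stays insensitive in \<open>y\<close>.\<close>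
    define g where "g S = (SOME t. t \<in> templates ?K q a \<and> inst t ` words ?K q \<subseteq> S)" for S
    define V where "V y = inst (g (F y)) ` words ?K q" for y
    define Y where "Y = {y\<in>words ?K ?b. e / 2 * card (words ?K a) \<le> card (F y)}"
    have g: "g (F y) \<in> templates ?K q a" "V y \<subseteq> F y" if "y \<in> Y" for y
    proof -
      have "\<exists>t. t \<in> templates ?K q a \<and> inst t ` words ?K q \<subseteq> F y"
        using a[of "F y"] F_ins that by (auto simp: Y_def F_def)
      from someI_ex[OF this] show "g (F y) \<in> templates ?K q a" "V y \<subseteq> F y"
        by (simp_all add: g_def V_def)
    qed
    define E0 where "E0 = (\<Union>y\<in>Y. (\<lambda>x. x @ y) ` V y)"
    have finY: "finite Y" by (simp add: Y_def)
    have E0_part: "E0 \<in> subspace_unions ?K q (a + ?b)"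
      unfolding E0_def
    proof (rule subspace_unions_UN[OF finY])
      fix y assume y: "y \<in> Y"
      have "inst (g (F y) @ map Inl y) ` words ?K q \<in> subspace_unions ?K q (a + ?b)"
        using y by (intro subspace_unions_single suffix_in_templates g) (simp_all add: Y_def)
      then show "(\<lambda>x. x @ y) ` V y \<in> subspace_unions ?K q (a + ?b)"
        by (simp add: V_def image_image)
    next
      fix y y' assume "y \<in> Y" "y' \<in> Y" "y \<noteq> y'"
      then show "(\<lambda>x. x @ y) ` V y \<inter> (\<lambda>x. x @ y') ` V y' = {}"
        by (auto simp: Y_def words_def)
    qed
    have E0_D: "E0 \<subseteq> D" using g(2) by (auto simp: E0_def F_def)
    have E0_iff: "x @ y \<in> E0 \<longleftrightarrow> y \<in> Y \<and> x \<in> V y" if "y \<in> words ?K ?b" for x y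
      using that by (auto simp: E0_def Y_def words_def)
    have cY: "card Y \<le> card E0"
    proof (rule card_inj_on_le)
      let ?h = "\<lambda>y. inst (g (F y)) (replicate q 0) @ y"
      show "inj_on ?h Y" by (auto simp: inj_on_def Y_def words_def)
      have "replicate q 0 \<in> words ?K q" by (auto simp: words_def)
      then show "?h ` Y \<subseteq> E0" by (auto simp: E0_def V_def)
      show "finite E0" using E0_part by (rule finite_subspace_unions)
    qed
    have "real (card D) = (\<Sum>y\<in>words ?K ?b. real (card (F y)))"
      using card_words_append'[of ?K a ?b "\<lambda>w. w \<in> D"] D(1) by (simp add: F_def Int_absorb1 Collect_conj_eq)
    also have "\<dots> \<le> (\<Sum>y\<in>words ?K ?b. e / 2 * real ?K ^ a + (if y \<in> Y then real ?K ^ a else 0))"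
    proof (rule sum_mono)
      fix y assume "y \<in> words ?K ?b"
      moreover have "card (F y) \<le> card (words ?K a)" by (intro card_mono) (auto simp: F_def)
      then have "real (card (F y)) \<le> real ?K ^ a" by (simp del: of_nat_Suc flip: of_nat_power)
      ultimately show "real (card (F y)) \<le> e / 2 * real ?K ^ a + (if y \<in> Y then real ?K ^ a else 0)"
        using assms(2) by (auto simp: Y_def add_increasing simp del: of_nat_Suc)
    qed
    also have "\<dots> = e / 2 * real ?K ^ (a + ?b) + real ?K ^ a * card Y"
    proof -
      have "words ?K ?b \<inter> {y. y \<in> Y} = Y" by (auto simp: Y_def)
      then show ?thesis by (simp add: sum.distrib sum.If_cases power_add del: of_nat_Suc)
    qed
    finally have "card D - e / 2 * real ?K ^ (a + ?b) \<le> real ?K ^ a * card E0"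
      using cY by (smt (verit, best) mult_left_mono of_nat_0_le_iff of_nat_mono zero_le_power)
    then have "(card D - e / 2 * real ?K ^ (a + ?b)) / real ?K ^ a \<le> card E0"
      by (simp add: divide_le_eq mult.commute del: of_nat_Suc)
    moreover have "real (card (D - E0)) = real (card D) - real (card E0)"
      using E0_D finite_subset[OF D(1)] finite_subspace_unions[OF E0_part]
      by (simp add: card_Diff_subset card_mono of_nat_diff)
    moreover have "c * z = z - z / real ?K ^ a" for z by (simp add: c_def left_diff_distrib)
    ultimately have step: "real (card (D - E0)) - e / 2 * real ?K ^ (a + ?b) \<le> c * (card D - e / 2 * real ?K ^ (a + ?b))"
      by (smt (verit))
    \<comment> \<open>The remainder need not be insensitive in the first \<open>a\<close> letters,
      so these are fixed and the induction hypothesis is applied to each fibre over them.\<close>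
    define D' where "D' x = {y\<in>words ?K ?b. x @ y \<in> D - E0}" for x
    have "insensitive i k ?b (D' x)" if x: "x \<in> words ?K a" for x
      unfolding insensitive_def
    proof
      fix y assume y: "y \<in> words ?K ?b"
      have y': "merge i k y \<in> words ?K ?b" using merge_in_words_Suc[OF assms(3) y] .
      have "x @ y \<in> D \<longleftrightarrow> x @ merge i k y \<in> D" using Dm x y y' assms(3) by simp
      moreover have "x @ y \<in> E0 \<longleftrightarrow> x @ merge i k y \<in> E0"
        unfolding E0_iff[OF y] E0_iff[OF y'] using y y' F_merge[OF y] by (simp add: Y_def V_def)
      ultimately show "y \<in> D' x \<longleftrightarrow> merge i k y \<in> D' x" using y y' by (simp add: D'_def)
    qed
    then have "\<exists>E\<in>subspace_unions ?K q ?b. E \<subseteq> D' x \<and>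
      card (D' x - E) \<le> e / 2 * real ?K ^ ?b + c ^ j * (card (D' x) - e / 2 * real ?K ^ ?b)"
      if "x \<in> words ?K a" for x
      using Suc.IH[of "D' x"] that by (auto simp: D'_def)
    then obtain R where R: "\<And>x. x \<in> words ?K a \<Longrightarrow> R x \<in> subspace_unions ?K q ?b"
      "\<And>x. x \<in> words ?K a \<Longrightarrow> R x \<subseteq> D' x"
      "\<And>x. x \<in> words ?K a \<Longrightarrow>
        card (D' x - R x) \<le> e / 2 * real ?K ^ ?b + c ^ j * (card (D' x) - e / 2 * real ?K ^ ?b)"
      by metis
    define E1 where "E1 = (\<Union>x\<in>words ?K a. (\<lambda>y. x @ y) ` R x)"
    have E1_part: "E1 \<in> subspace_unions ?K q (a + ?b)"
      unfolding E1_def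
    proof (rule subspace_unions_UN[OF finite_words])
      fix x assume x: "x \<in> words ?K a"
      have "inst (map Inl x @ id_template ?b) ` R x = (\<lambda>y. x @ y) ` R x"
        using R(2)[OF x] by (intro image_cong) (auto simp: D'_def length_word)
      then show "(\<lambda>y. x @ y) ` R x \<in> subspace_unions ?K q (a + ?b)"
        using subspace_unions_image[OF R(1)[OF x] prefix_in_templates[OF x id_template_in_templates]] by simp
    next
      fix x x' assume "x \<in> words ?K a" "x' \<in> words ?K a" "x \<noteq> x'"
      then show "(\<lambda>y. x @ y) ` R x \<inter> (\<lambda>y. x' @ y) ` R x' = {}" by (auto simp: words_def)
    qed
    have E1_D: "E1 \<subseteq> D - E0" using R(2) by (auto simp: E1_def D'_def)
    have E1_iff: "x @ y \<in> E1 \<longleftrightarrow> y \<in> R x" if "x \<in> words ?K a" for x y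
    proof
      assume "x @ y \<in> E1"
      then obtain x' y' where x': "x' \<in> words ?K a" "y' \<in> R x'" "x @ y = x' @ y'"
        unfolding E1_def by blast
      then have "x = x' \<and> y = y'" using length_word[OF that] length_word[OF x'(1)] by simp
      then show "y \<in> R x" using x'(2) by simp
    next
      assume "y \<in> R x"
      then show "x @ y \<in> E1" using that unfolding E1_def by blast
    qed
    have "real (card (D - E0 - E1)) = (\<Sum>x\<in>words ?K a. real (card (D' x - R x)))"
    proof -
      have "card (D - E0 - E1) = (\<Sum>x\<in>words ?K a. card (D' x - {y. x @ y \<in> E1}))"
        unfolding D'_def using D(1) by (intro card_Diff_fibres) auto
      also have "\<dots> = (\<Sum>x\<in>words ?K a. card (D' x - R x))"
        by (intro sum.cong refl) (simp add: E1_iff)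
      finally show ?thesis by simp
    qed
    also have "\<dots> \<le> (\<Sum>x\<in>words ?K a. e / 2 * real ?K ^ ?b + c ^ j * (card (D' x) - e / 2 * real ?K ^ ?b))"
      by (intro sum_mono R(3))
    also have "\<dots> = e / 2 * real ?K ^ (a + ?b) + c ^ j * ((\<Sum>x\<in>words ?K a. real (card (D' x))) - e / 2 * real ?K ^ (a + ?b))"
      by (simp add: sum.distrib sum_subtractf power_add algebra_simps flip: sum_distrib_left del: of_nat_Suc)
    also have "(\<Sum>x\<in>words ?K a. real (card (D' x))) = card (D - E0)"
    proof -
      have "D - E0 \<subseteq> words ?K (a + ?b)" using D(1) by blast
      from card_fibres_append[OF this] show ?thesis by (simp add: D'_def)
    qed
    also have "c ^ j * (card (D - E0) - e / 2 * real ?K ^ (a + ?b))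
        \<le> c ^ j * (c * (card D - e / 2 * real ?K ^ (a + ?b)))"
      using step c(1) by (intro mult_left_mono) auto
    finally have fin: "card (D - (E0 \<union> E1)) \<le> e / 2 * real ?K ^ (a + ?b)
        + c ^ Suc j * (card D - e / 2 * real ?K ^ (a + ?b))"
      by (simp add: Diff_eq Int_assoc mult_ac)
    have "E0 \<union> E1 \<in> subspace_unions ?K q (a + ?b)"
      using E0_part E1_part E1_D by (intro subspace_unions_Un) auto
    then show ?case using fin E0_D E1_D by (intro bexI[of _ "E0 \<union> E1"]) auto
  qed
  obtain j where j: "c ^ j < e / 2" using real_arch_pow_inv[OF e2 c(2)] by blast
  have "\<exists>E\<in>subspace_unions ?K q (a * j). E \<subseteq> D \<and> card (D - E) \<le> e * real ?K ^ (a * j)"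
    if D: "D \<subseteq> words ?K (a * j)" "insensitive i k (a * j) D" for D
  proof -
    obtain E where E: "E \<in> subspace_unions ?K q (a * j)" "E \<subseteq> D"
      "card (D - E) \<le> e / 2 * real ?K ^ (a * j) + c ^ j * (card D - e / 2 * real ?K ^ (a * j))"
      using claim[OF D] by blast
    have "real (card D) \<le> real ?K ^ (a * j)"
      using card_mono[OF finite_words D(1)] by (simp del: of_nat_Suc flip: of_nat_power)
    then have "c ^ j * (card D - e / 2 * real ?K ^ (a * j)) \<le> c ^ j * real ?K ^ (a * j)"
      using c(1) e2 by (intro mult_left_mono) (auto simp: add_increasing2 algebra_simps intro: order_trans)
    also have "\<dots> \<le> e / 2 * real ?K ^ (a * j)" using j by (intro mult_right_mono) auto
    finally have "card (D - E) \<le> e * real ?K ^ (a * j)" using E(3) by simp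
    then show ?thesis using E by blast
  qed
  then show ?thesis by blast
qed

text \<open>Each subspace composing \<open>E0\<close> is refined separately. They are disjoint, so
  the exceptional sets add up to a proportion of at most \<open>e\<close> of
  \<open>E0\<close>.\<close>

lemma refine_subspace_unions:
  fixes e :: real
  assumes "E0 \<in> subspace_unions k n1 n" "D \<subseteq> words k n"
    and "\<And>t. t \<in> templates k n1 n \<Longrightarrow> \<exists>E\<in>subspace_unions k q n1. inst t ` E \<subseteq> D \<and>
      card ({w\<in>words k n1. inst t w \<in> D} - E) \<le> e * card (words k n1)"
  shows "\<exists>E\<in>subspace_unions k q n. E \<subseteq> D \<inter> E0 \<and> card (D \<inter> E0 - E) \<le> e * card E0"
  using assms(1)
proof (induction rule: subspace_unions.induct)
  case empty
  show ?case by (intro bexI[of _ "{}"]) (auto intro: subspace_unions.empty)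
next
  case (add E0 t)
  let ?V = "inst t ` words k n1"
  have t: "t \<in> templates k n1 n" by fact
  have inj: "inj_on (inst t) (words k n1)" using t by (rule inj_on_inst)
  obtain E where E: "E \<in> subspace_unions k q n" "E \<subseteq> D \<inter> E0" "card (D \<inter> E0 - E) \<le> e * card E0"
    using add.IH by blast
  obtain F where F: "F \<in> subspace_unions k q n1" "inst t ` F \<subseteq> D"
    "card ({w\<in>words k n1. inst t w \<in> D} - F) \<le> e * card (words k n1)"
    using assms(3)[OF t] by blast
  have FV: "inst t ` F \<subseteq> ?V" using subspace_unions_subset[OF F(1)] by auto
  have "D \<inter> ?V - inst t ` F = inst t ` ({w\<in>words k n1. inst t w \<in> D} - F)"
    using inj_on_image_set_diff[OF inj _ subspace_unions_subset[OF F(1)], of "{w\<in>words k n1. inst t w \<in> D}"]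
    by auto
  then have "card (D \<inter> ?V - inst t ` F) \<le> e * card ?V"
  proof -
    have "{w\<in>words k n1. inst t w \<in> D} - F \<subseteq> words k n1" by auto
    from card_image[OF inj_on_subset[OF inj this]] \<open>D \<inter> ?V - inst t ` F = _\<close>
    show ?thesis using F(3) card_image[OF inj] by simp
  qed
  moreover have "card (D \<inter> (?V \<union> E0) - (inst t ` F \<union> E)) \<le> card (D \<inter> ?V - inst t ` F) + card (D \<inter> E0 - E)"
    by (rule order_trans[OF card_mono card_Un_le]) (use assms(2) in \<open>auto intro: finite_subset\<close>)
  moreover have "card (?V \<union> E0) = card ?V + card E0"
    using finite_subspace_unions[OF add.hyps(1)] add.hyps(3) by (intro card_Un_disjoint) auto
  ultimately have "card (D \<inter> (?V \<union> E0) - (inst t ` F \<union> E)) \<le> e * card (?V \<union> E0)"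
    using E(3) by (simp add: distrib_left)
  moreover have "inst t ` F \<union> E \<in> subspace_unions k q n"
    using FV E(2) add.hyps(3) by (intro subspace_unions_Un subspace_unions_image[OF F(1) t] E(1)) blast
  ultimately show ?case using F(2) FV E(2) by (intro bexI[of _ "inst t ` F \<union> E"]) auto
qed

text \<open>Induction on the number of sets. The last set is almost partitioned into subspaces of
  dimension \<open>n1\<close>; in each of them the other sets are still insensitive and the
  induction hypothesis applies. Each stage costs \<open>e / 2\<close>.\<close>

lemma partition_insensitives:
  assumes "\<And>d. 0 < d \<Longrightarrow> \<exists>n. DHJ k d n" "0 < e" "l \<le> k"
  shows "\<exists>n. \<forall>D. (\<forall>i<l. insensitive i k n (D i)) \<longrightarrow>
    (\<exists>E\<in>subspace_unions (Suc k) q n. E \<subseteq> {w\<in>words (Suc k) n. \<forall>i<l. w \<in> D i} \<and>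
      card ({w\<in>words (Suc k) n. \<forall>i<l. w \<in> D i} - E) \<le> e * real (Suc k) ^ n)"
  using assms(2,3)
proof (induction l arbitrary: e)
  case 0
  have "words (Suc k) q \<in> subspace_unions (Suc k) q q"
  proof -
    have "inst (id_template q) ` words (Suc k) q = (\<lambda>w. w) ` words (Suc k) q"
      by (intro image_cong) (auto simp: length_word)
    then show ?thesis using subspace_unions_single[OF id_template_in_templates, of q "Suc k"] by simp
  qed
  then show ?case using 0 by (intro exI[of _ q] allI impI bexI[of _ "words (Suc k) q"]) auto
next
  case (Suc l)
  let ?K = "Suc k"
  have e2: "0 < e / 2" "l \<le> k" "l < k" using Suc.prems by auto
  obtain n1 where n1: "\<And>D. (\<forall>i<l. insensitive i k n1 (D i)) \<Longrightarrow>
    (\<exists>E\<in>subspace_unions ?K q n1. E \<subseteq> {w\<in>words ?K n1. \<forall>i<l. w \<in> D i} \<and>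
      card ({w\<in>words ?K n1. \<forall>i<l. w \<in> D i} - E) \<le> e / 2 * real ?K ^ n1)"
    using Suc.IH[OF e2(1,2)] by blast
  obtain n where n: "\<And>D. \<lbrakk>D \<subseteq> words ?K n; insensitive l k n D\<rbrakk> \<Longrightarrow>
    (\<exists>E\<in>subspace_unions ?K n1 n. E \<subseteq> D \<and> card (D - E) \<le> e / 2 * real ?K ^ n)"
    using partition_insensitive[OF assms(1) e2(1,3)] by blast
  have "\<exists>E\<in>subspace_unions ?K q n. E \<subseteq> {w\<in>words ?K n. \<forall>i<Suc l. w \<in> D i} \<and>
      card ({w\<in>words ?K n. \<forall>i<Suc l. w \<in> D i} - E) \<le> e * real ?K ^ n"
    if D: "\<forall>i<Suc l. insensitive i k n (D i)" for D
  proof -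
    let ?D = "{w\<in>words ?K n. \<forall>i<l. w \<in> D i}" and ?Dl = "D l \<inter> words ?K n"
    have "insensitive l k n ?Dl"
      using D merge_in_words_Suc[OF e2(3)] by (auto simp: insensitive_def)
    then obtain E0 where E0: "E0 \<in> subspace_unions ?K n1 n" "E0 \<subseteq> ?Dl"
      "card (?Dl - E0) \<le> e / 2 * real ?K ^ n"
      using n[of ?Dl] by auto
    have "\<exists>E\<in>subspace_unions ?K q n. E \<subseteq> ?D \<inter> E0 \<and> card (?D \<inter> E0 - E) \<le> e / 2 * card E0"
    proof (rule refine_subspace_unions[OF E0(1)])
      fix t assume t: "t \<in> templates ?K n1 n"
      have "\<forall>i<l. insensitive i k n1 {w. inst t w \<in> D i}"
        using D insensitive_inst[OF _ t] e2(2) by auto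
      from n1[OF this] obtain E where "E \<in> subspace_unions ?K q n1"
        "E \<subseteq> {w\<in>words ?K n1. \<forall>i<l. inst t w \<in> D i}"
        "card ({w\<in>words ?K n1. \<forall>i<l. inst t w \<in> D i} - E) \<le> e / 2 * real ?K ^ n1"
        by auto
      moreover have "{w\<in>words ?K n1. inst t w \<in> ?D} = {w\<in>words ?K n1. \<forall>i<l. inst t w \<in> D i}"
        using inst_in_words[OF t] by auto
      ultimately show "\<exists>E\<in>subspace_unions ?K q n1. inst t ` E \<subseteq> ?D \<and>
          card ({w\<in>words ?K n1. inst t w \<in> ?D} - E) \<le> e / 2 * card (words ?K n1)"
        using inst_in_words[OF t] by (intro bexI[of _ E]) auto
    qed auto
    then obtain E where E: "E \<in> subspace_unions ?K q n" "E \<subseteq> ?D \<inter> E0"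
      "card (?D \<inter> E0 - E) \<le> e / 2 * card E0" by blast
    have "card E0 \<le> card (words ?K n)"
      using subspace_unions_subset[OF E0(1)] by (intro card_mono) auto
    then have "e / 2 * card E0 \<le> e / 2 * real ?K ^ n"
      using e2(1) by (intro mult_left_mono) (auto simp del: of_nat_Suc simp flip: of_nat_power)
    moreover have "card ({w\<in>words ?K n. \<forall>i<Suc l. w \<in> D i} - E) \<le> card (?Dl - E0) + card (?D \<inter> E0 - E)"
      by (rule order_trans[OF card_mono card_Un_le]) (auto intro: finite_subset[OF _ finite_words])
    ultimately have "card ({w\<in>words ?K n. \<forall>i<Suc l. w \<in> D i} - E) \<le> e * real ?K ^ n"
      using E(3) E0(3) by linarith
    moreover have "E \<subseteq> {w\<in>words ?K n. \<forall>i<Suc l. w \<in> D i}"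
      using E(2) E0(2) by (auto simp: less_Suc_eq)
    ultimately show ?thesis using E(1) by blast
  qed
  then show ?case by blast
qed

section \<open>The density Hales--Jewett theorem\<close>

text \<open>The leading wildcard records which point of the encoded line is taken. For
  \<open>c = k\<close> it is \<open>x\<close> itself preceded by \<open>k\<close>, since
  \<open>merge k k\<close> is the identity.\<close>

lemma inst_line_of:
  assumes "U \<in> templates k (Suc m) n" "x \<in> words (Suc k) m"
  shows "tinst U (Inr 0 # line_of k x) \<in> templates k 1 n"
    and "inst (tinst U (Inr 0 # line_of k x)) [c] = inst U (c # merge c k x)"
proof -
  have l: "Inr 0 # line_of k x \<in> templates k 1 (Suc m)"
    using assms(2) by (auto simp: templates_def line_of_def words_def)
  then show "tinst U (Inr 0 # line_of k x) \<in> templates k 1 n"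
    by (rule tinst_in_templates[OF assms(1)])
  have "inst (line_of k x) [c] = merge c k x"
    using assms(2) by (auto simp: inst_def line_of_def merge_def words_def)
  then show "inst (tinst U (Inr 0 # line_of k x)) [c] = inst U (c # merge c k x)"
    unfolding inst_tinst[OF assms(1) length_template[OF l]] by simp
qed

lemma merge_self [simp]: "merge k k x = x"
  by (simp add: merge_def)

text \<open>For \<open>D\<^sub>i y = {x. (\<forall>j<i. C j x y) \<and> \<not> C i x y}\<close> the sets \<open>D\<^sub>i y\<close>, \<open>i < k\<close>, partition the complement
  of \<open>\<Inter>\<^sub>i C\<^sub>i\<close>, which contains \<open>B\<close> but is not everything; so \<open>B\<close> is denser than average on some piece.\<close>

lemma correlated_piece:
  fixes B :: "'a \<Rightarrow> 'b \<Rightarrow> bool" and C :: "nat \<Rightarrow> 'a \<Rightarrow> 'b \<Rightarrow> bool" and b d g th :: real and k :: nat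
  assumes fin: "finite X" "finite Y" "X \<noteq> {}" "Y \<noteq> {}" and k: "0 < k"
    and disj: "\<And>x y. x \<in> X \<Longrightarrow> y \<in> Y \<Longrightarrow> B x y \<Longrightarrow> \<exists>i<k. \<not> C i x y"
    and B: "\<And>x. x \<in> X \<Longrightarrow> b * card Y \<le> card {y\<in>Y. B x y}"
    and C: "\<And>x. x \<in> X \<Longrightarrow> th * card Y \<le> card {y\<in>Y. \<forall>i<k. C i x y}"
    and ineq: "d * (1 - th) + k * g \<le> b" and d: "0 \<le> d"
  shows "\<exists>i<k. \<exists>y\<in>Y. d * card {x\<in>X. (\<forall>j<i. C j x y) \<and> \<not> C i x y} + g * card X
    \<le> card {x\<in>X. B x y \<and> (\<forall>j<i. C j x y) \<and> \<not> C i x y}"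
proof (rule ccontr)
  define D where "D i y = {x\<in>X. (\<forall>j<i. C j x y) \<and> \<not> C i x y}" for i y
  define BD where "BD i y = {x\<in>X. B x y \<and> (\<forall>j<i. C j x y) \<and> \<not> C i x y}" for i y
  assume "\<not> ?thesis"
  then have less: "card (BD i y) < d * card (D i y) + g * card X" if "i < k" "y \<in> Y" for i y
    using that by (auto simp: D_def BD_def not_le)
  have first: "\<exists>i<k. (\<forall>j<i. C j x y) \<and> \<not> C i x y" if ex: "\<exists>i<k. \<not> C i x y" for x y
  proof -
    obtain i0 where i0: "i0 < k" "\<not> C i0 x y" using ex by blast
    let ?i = "LEAST i. \<not> C i x y"
    have "?i < k" using Least_le[of "\<lambda>i. \<not> C i x y", OF i0(2)] i0(1) by linarith
    moreover have "\<not> C ?i x y" by (rule LeastI[of "\<lambda>i. \<not> C i x y", OF i0(2)])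
    moreover have "\<forall>j<?i. C j x y" using not_less_Least[of _ "\<lambda>i. \<not> C i x y"] by blast
    ultimately show ?thesis by blast
  qed
  have disj_D: "D i y \<inter> D j y = {}" if "i \<noteq> j" for i j y
    using that by (auto simp: D_def) (metis linorder_neqE_nat)
  have BD_D: "BD i y \<subseteq> D i y" for i y by (auto simp: BD_def D_def)
  have cB: "card {x\<in>X. B x y} = (\<Sum>i<k. card (BD i y))" if "y \<in> Y" for y
  proof -
    have "\<exists>i<k. x \<in> BD i y" if "x \<in> X" "B x y" for x
      using first[OF disj[OF that(1) \<open>y \<in> Y\<close> that(2)]] that by (auto simp: BD_def)
    then have "{x\<in>X. B x y} = (\<Union>i<k. BD i y)" by (auto simp: BD_def)
    moreover have "card (\<Union>i<k. BD i y) = (\<Sum>i<k. card (BD i y))"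
    proof (intro card_UN_disjoint ballI impI)
      show "BD i y \<inter> BD j y = {}" if "i \<noteq> j" for i j
        using disj_D[OF that] BD_D[of i y] BD_D[of j y] by blast
    qed (use fin(1) in \<open>auto simp: BD_def\<close>)
    ultimately show ?thesis by simp
  qed
  have cD: "real (card {x\<in>X. \<forall>i<k. C i x y}) + (\<Sum>i<k. real (card (D i y))) = card X" for y
  proof -
    have "\<exists>i<k. x \<in> D i y" if "x \<in> X" "\<not> (\<forall>i<k. C i x y)" for x
      using first[of x y] that by (auto simp: D_def)
    then have X: "X = {x\<in>X. \<forall>i<k. C i x y} \<union> (\<Union>i<k. D i y)"
      by (auto simp: D_def)
    have "card X = card {x\<in>X. \<forall>i<k. C i x y} + card (\<Union>i<k. D i y)"
      by (subst X, rule card_Un_disjoint) (use fin(1) in \<open>auto simp: D_def\<close>)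
    also have "card (\<Union>i<k. D i y) = (\<Sum>i<k. card (D i y))"
      using fin(1) disj_D by (intro card_UN_disjoint) (auto simp: D_def)
    finally show ?thesis by simp
  qed
  \<comment> \<open>Double counting of \<open>B\<close>: if no piece had the increment, the sizes of
    the pieces would bound \<open>B\<close> from above, and the pieces miss the intersection of the
    \<open>C i\<close>, of density at least \<open>th\<close>.\<close>
  have "b * card Y * card X = (\<Sum>x\<in>X. b * card Y)" by simp
  also have "\<dots> \<le> (\<Sum>x\<in>X. real (card {y\<in>Y. B x y}))" by (intro sum_mono B)
  also have "\<dots> = (\<Sum>y\<in>Y. real (card {x\<in>X. B x y}))"
    unfolding of_nat_sum[symmetric] by (subst sum_card_swap[OF fin(1,2)]) simp
  also have "\<dots> = (\<Sum>y\<in>Y. \<Sum>i<k. real (card (BD i y)))" by (simp add: cB)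
  also have "\<dots> < (\<Sum>y\<in>Y. \<Sum>i<k. d * card (D i y) + g * card X)"
    using k by (intro sum_strict_mono fin less) auto
  also have "\<dots> = d * (\<Sum>y\<in>Y. \<Sum>i<k. real (card (D i y))) + k * g * card X * card Y"
    by (simp add: sum.distrib sum_distrib_left mult_ac)
  also have "(\<Sum>y\<in>Y. \<Sum>i<k. real (card (D i y))) = (\<Sum>y\<in>Y. card X - real (card {x\<in>X. \<forall>i<k. C i x y}))"
    by (intro sum.cong refl) (use cD in \<open>simp add: eq_diff_eq add.commute\<close>)
  also have "\<dots> = card X * card Y - (\<Sum>x\<in>X. real (card {y\<in>Y. \<forall>i<k. C i x y}))"
    unfolding of_nat_sum[symmetric] sum_card_swap[OF fin(1,2)] by (simp add: sum_subtractf)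
  also have "\<dots> \<le> card X * card Y - (\<Sum>x\<in>X. th * card Y)"
    by (intro diff_left_mono sum_mono C)
  also have "\<dots> = (1 - th) * card X * card Y" by (simp add: algebra_simps)
  finally have "b * card Y * card X < d * ((1 - th) * card X * card Y) + k * g * card X * card Y"
    using d by (simp add: mult_left_mono)
  also have "\<dots> = (d * (1 - th) + k * g) * (card X * card Y)" by (simp add: algebra_simps)
  also have "\<dots> \<le> b * (card X * card Y)" using ineq by (intro mult_right_mono) auto
  finally show False by (simp add: mult_ac)
qed

text \<open>For fixed \<open>k\<close> the increment \<gamma> depends on \<open>d0\<close> only, so
  it can be applied repeatedly. The denser subspace is found with a fixed prefix \<open>u\<close>
  and tail \<open>y\<close>, inside a subspace \<open>U\<close> all of whose encoded lines are
  good.\<close>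

lemma density_increment:
  assumes DHJ: "\<And>d. 0 < d \<Longrightarrow> \<exists>n. DHJ k d n" and k: "0 < k" and d0: "0 < d0"
  shows "\<exists>\<gamma>>0::real. \<forall>d\<ge>d0. \<forall>m. \<exists>n. \<forall>A\<subseteq>words (Suc k) n. d * real (Suc k) ^ n \<le> card A \<longrightarrow>
    has_line (Suc k) n A \<or>
    (\<exists>t\<in>templates (Suc k) m n. (d + \<gamma>) * real (Suc k) ^ m \<le> card {w\<in>words (Suc k) m. inst t w \<in> A})"
proof -
  let ?K = "Suc k"
  obtain a where a: "DHJ k (d0 / 2 / 2) a" using DHJ[of "d0 / 2 / 2"] d0 by auto
  obtain \<theta>0 :: real where \<theta>0: "0 < \<theta>0"
    "\<And>(Y :: nat list set) S. \<lbrakk>finite Y; Y \<noteq> {};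
      d0 / 2 * k ^ a * card Y \<le> (\<Sum>y\<in>Y. real (card {w\<in>words k a. S w y}))\<rbrakk> \<Longrightarrow>
      \<exists>t\<in>templates k 1 a. \<theta>0 * card Y \<le> card {y\<in>Y. \<forall>c<k. S (inst t [c]) y}"
    using DHJ_average[OF a _ k] d0 by auto
  define \<theta> where "\<theta> = min \<theta>0 1"
  have \<theta>: "0 < \<theta>" "\<theta> \<le> 1" "\<theta> \<le> \<theta>0" using \<theta>0(1) by (auto simp: \<theta>_def)
  \<comment> \<open>The points missed by \<open>A\<close> bring a gain of at least
    \<open>d0 * \<theta>\<close>. One half pays for the loss \<eta> in passing to fibres, the other
    half supplies \<gamma> once for the increment and once for each of the \<open>k\<close>
    pieces.\<close>
  define \<eta> where "\<eta> = d0 * \<theta> / 2"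
  define \<gamma> where "\<gamma> = \<eta> / ?K"
  have \<eta>: "0 < \<eta>" "\<eta> \<le> d0 / 2" using d0 \<theta> by (auto simp: \<eta>_def mult_le_cancel_left1)
  have "\<gamma> + k * \<gamma> = ?K * \<gamma>" by (simp add: algebra_simps)
  then have \<gamma>: "0 < \<gamma>" "\<gamma> + k * \<gamma> = \<eta>" using \<eta>(1) by (simp_all add: \<gamma>_def del: of_nat_Suc)
  have "\<exists>n. \<forall>A\<subseteq>words ?K n. d * real ?K ^ n \<le> card A \<longrightarrow>
      has_line ?K n A \<or>
      (\<exists>t\<in>templates ?K m n. (d + \<gamma>) * real ?K ^ m \<le> card {w\<in>words ?K m. inst t w \<in> A})"
    if d: "d0 \<le> d" for d m
  proof -
    have "0 < \<gamma> / 2" using \<gamma>(1) by simp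
    from partition_insensitives[OF DHJ this order_refl, of m]
    obtain b where b: "\<And>D. \<forall>i<k. insensitive i k b (D i) \<Longrightarrow>
      \<exists>E\<in>subspace_unions ?K m b. E \<subseteq> {w\<in>words ?K b. \<forall>i<k. w \<in> D i} \<and>
        card ({w\<in>words ?K b. \<forall>i<k. w \<in> D i} - E) \<le> \<gamma> / 2 * real ?K ^ b"
      by blast
    obtain M where M: "\<And>G. \<forall>W\<in>templates k a M. \<exists>l\<in>templates k 1 a. G (tinst W l) \<Longrightarrow>
      \<exists>U\<in>templates k (Suc b) M. \<forall>x\<in>words ?K b. G (tinst U (Inr 0 # line_of k x))"
      using good_lines[OF k, of a b] by blast
    obtain n where n: "\<And>A. \<lbrakk>A\<subseteq>words ?K n; d * real ?K ^ n \<le> card A\<rbrakk> \<Longrightarrow>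
      \<exists>p u q. n = p + M + q \<and> u \<in> words ?K p \<and>
        (\<forall>t\<in>words ?K M. (d - \<eta>) * real ?K ^ q \<le> card {y\<in>words ?K q. u @ t @ y \<in> A})"
      using dense_fibres[OF \<eta>(1), of ?K d M] by blast
    have "\<exists>t\<in>templates ?K m n. (d + \<gamma>) * real ?K ^ m \<le> card {w\<in>words ?K m. inst t w \<in> A}"
      if A: "A\<subseteq>words ?K n" "d * real ?K ^ n \<le> card A" and no_line: "\<not> has_line ?K n A" for A
    proof -
      obtain p u q where u: "n = p + M + q" "u \<in> words ?K p"
        "\<And>t. t\<in>words ?K M \<Longrightarrow> (d - \<eta>) * real ?K ^ q \<le> card {y\<in>words ?K q. u @ t @ y \<in> A}"
        using n[OF A] by blast
      define Y where "Y = words ?K q"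
      have Y: "finite Y" "Y \<noteq> {}" "card Y = ?K ^ q"
        using words_nonempty[of ?K q] by (auto simp: Y_def)
      have dense: "(d - \<eta>) * card Y \<le> card {y\<in>Y. u @ t @ y \<in> A}" if "t \<in> words ?K M" for t
        using u(3)[OF that] by (simp add: Y_def)
      \<comment> \<open>A line is good if at least a proportion \<theta> of the tails puts its first
        \<open>k\<close> points into \<open>A\<close>. By \<open>DHJ_average\<close> every
        \<open>a\<close>-dimensional subspace contains a good line.\<close>
      define G where "G l \<longleftrightarrow> \<theta> * card Y \<le> card {y\<in>Y. \<forall>c<k. u @ inst l [c] @ y \<in> A}" for l
      have "\<exists>l\<in>templates k 1 a. G (tinst W l)" if W: "W \<in> templates k a M" for W
      proof -
        have "d0 / 2 * k ^ a * card Y = (\<Sum>w\<in>words k a. d0 / 2 * card Y)" by simp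
        also have "\<dots> \<le> (\<Sum>w\<in>words k a. real (card {y\<in>Y. u @ inst W w @ y \<in> A}))"
        proof (rule sum_mono)
          fix w assume "w \<in> words k a"
          then have "inst W w \<in> words ?K M"
            using inst_in_words[OF W] words_mono[of k ?K M] by auto
          moreover have "d0 / 2 * card Y \<le> (d - \<eta>) * card Y"
            using d \<eta>(2) by (intro mult_right_mono) auto
          ultimately show "d0 / 2 * card Y \<le> real (card {y\<in>Y. u @ inst W w @ y \<in> A})"
            using dense by fastforce
        qed
        also have "\<dots> = (\<Sum>y\<in>Y. real (card {w\<in>words k a. u @ inst W w @ y \<in> A}))"
          unfolding of_nat_sum[symmetric] by (subst sum_card_swap[OF finite_words Y(1)]) simp
        finally obtain l where l: "l \<in> templates k 1 a"
          "\<theta>0 * card Y \<le> card {y\<in>Y. \<forall>c<k. u @ inst W (inst l [c]) @ y \<in> A}"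
          using \<theta>0(2)[OF Y(1,2), of "\<lambda>w y. u @ inst W w @ y \<in> A"] by blast
        have "\<theta> * card Y \<le> \<theta>0 * card Y" using \<theta>(3) by (intro mult_right_mono) auto
        then have "G (tinst W l)"
          using l(2) by (simp add: G_def inst_tinst[OF W length_template[OF l(1)]])
        then show ?thesis using l(1) by blast
      qed
      then obtain U where U: "U \<in> templates k (Suc b) M"
        "\<And>x. x\<in>words ?K b \<Longrightarrow> G (tinst U (Inr 0 # line_of k x))"
        using M[of G] by blast
      have U': "U \<in> templates ?K (Suc b) M" using U(1) templates_mono[of k ?K] by auto
      \<comment> \<open>For \<open>i < k\<close> this concerns the \<open>i\<close>-th point of the
        line encoded by \<open>x\<close>, for \<open>i = k\<close> the word \<open>x\<close>
        preceded by \<open>k\<close>. As \<open>A\<close> contains no line, not all of them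
        hold.\<close>
      define C where "C i x y \<longleftrightarrow> u @ inst U (i # merge i k x) @ y \<in> A" for i x y
      define X where "X = words ?K b"
      have X: "finite X" "X \<noteq> {}" using words_nonempty[of ?K b] by (auto simp: X_def)
      have "\<exists>i<k. \<exists>y\<in>Y. (d + \<gamma>) * card {x\<in>X. (\<forall>j<i. C j x y) \<and> \<not> C i x y} + \<gamma> * card X
        \<le> card {x\<in>X. C k x y \<and> (\<forall>j<i. C j x y) \<and> \<not> C i x y}"
      proof (rule correlated_piece[OF X(1) Y(1) X(2) Y(2) k])
        fix x y assume x: "x \<in> X" and y: "y \<in> Y" and Ck: "C k x y"
        show "\<exists>i<k. \<not> C i x y"
        proof (rule ccontr)
          assume "\<not> ?thesis"
          then have all: "C c x y" if "c < ?K" for c using that Ck by (auto simp: less_Suc_eq)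
          define l where "l = tinst U (Inr 0 # line_of k x)"
          have "l \<in> templates ?K 1 M"
            using inst_line_of(1)[OF U(1)] x templates_mono[of k ?K] by (auto simp: l_def X_def)
          then have "map Inl u @ l @ map Inl y \<in> templates ?K 1 n"
            using prefix_in_templates[OF u(2) suffix_in_templates[of y ?K q l 1 M]] y u(1)
            by (simp add: Y_def add.assoc)
          moreover have "inst (map Inl u @ l @ map Inl y) [c] \<in> A" if "c < ?K" for c
            using all[OF that] inst_line_of(2)[OF U(1)] x by (simp add: l_def C_def X_def)
          ultimately show False using no_line unfolding has_line_def by blast
        qed
      next
        fix x assume x: "x \<in> X"
        have "inst U (k # merge k k x) \<in> words ?K M"
          using x by (intro inst_in_words[OF U']) (simp add: X_def)
        then show "(d - \<eta>) * card Y \<le> card {y\<in>Y. C k x y}" using dense by (simp add: C_def)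
        show "\<theta> * card Y \<le> card {y\<in>Y. \<forall>i<k. C i x y}"
          using U(2)[of x] inst_line_of(2)[OF U(1)] x by (simp add: G_def C_def X_def)
      next
        have "(d + \<gamma>) * (1 - \<theta>) + k * \<gamma> = d - d * \<theta> - \<gamma> * \<theta> + (\<gamma> + k * \<gamma>)" by (simp add: algebra_simps)
        also have "\<dots> \<le> d - d0 * \<theta> + \<eta>"
          using \<gamma> mult_right_mono[OF d, of \<theta>] mult_pos_pos[OF \<gamma>(1) \<theta>(1)] \<theta>(1) by linarith
        finally show "(d + \<gamma>) * (1 - \<theta>) + k * \<gamma> \<le> d - \<eta>" by (simp add: \<eta>_def mult.commute)
        show "0 \<le> d + \<gamma>" using d d0 \<gamma>(1) by linarith
      qed
      then obtain i y where i: "i < k" and y: "y \<in> Y"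
        and dense_D: "(d + \<gamma>) * card {x\<in>X. (\<forall>j<i. C j x y) \<and> \<not> C i x y} + \<gamma> * card X
          \<le> card {x\<in>X. C k x y \<and> (\<forall>j<i. C j x y) \<and> \<not> C i x y}" by blast
      \<comment> \<open>Writes the piece as an intersection of \<open>k\<close> sets.
        \<open>C j\<close> sees \<open>x\<close> only through \<open>merge j k x\<close>, so the
        \<open>j\<close>-th set is insensitive to exchanging \<open>j\<close> and
        \<open>k\<close>.\<close>
      define D where "D j = (if j < i then {x. C j x y} else if j = i then {x. \<not> C i x y} else UNIV)" for j
      have "\<forall>j<k. insensitive j k b (D j)" by (auto simp: insensitive_def D_def C_def)
      moreover have D: "{w\<in>words ?K b. \<forall>j<k. w \<in> D j} = {x\<in>X. (\<forall>j<i. C j x y) \<and> \<not> C i x y}"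
        using i by (auto simp: D_def X_def)
      ultimately obtain E where E: "E \<in> subspace_unions ?K m b"
        "E \<subseteq> {x\<in>X. (\<forall>j<i. C j x y) \<and> \<not> C i x y}"
        "card ({x\<in>X. (\<forall>j<i. C j x y) \<and> \<not> C i x y} - E) \<le> \<gamma> / 2 * card X"
        using b[of D] by (auto simp: X_def)
      define B where "B = {x. C k x y}"
      have "card {x\<in>X. C k x y \<and> (\<forall>j<i. C j x y) \<and> \<not> C i x y}
          \<le> card (B \<inter> E) + card ({x\<in>X. (\<forall>j<i. C j x y) \<and> \<not> C i x y} - E)"
        by (rule order_trans[OF card_mono card_Un_le])
           (use X(1) finite_subspace_unions[OF E(1)] in \<open>auto simp: B_def\<close>)
      moreover have "(d + \<gamma>) * card E \<le> (d + \<gamma>) * card {x\<in>X. (\<forall>j<i. C j x y) \<and> \<not> C i x y}"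
        using E(2) X(1) d d0 \<gamma>(1) by (intro mult_left_mono of_nat_mono card_mono) auto
      moreover have "0 < \<gamma> / 2 * card X" using \<gamma>(1) X by (simp add: card_gt_0_iff)
      ultimately have BE: "(d + \<gamma>) * card E < card (B \<inter> E)"
        using dense_D E(3) by linarith
      then have "E \<noteq> {}" by auto
      from dense_part[OF E(1) this less_imp_le[OF BE]]
      obtain t where t: "t \<in> templates ?K m b" "(d + \<gamma>) * real ?K ^ m \<le> card {w\<in>words ?K m. inst t w \<in> B}"
        by blast
      \<comment> \<open>\<open>B\<close> concerns points with leading letter \<open>k\<close>, so
        the first variable of \<open>U\<close> is set to \<open>k\<close>.\<close>
      define l where "l = tinst U (Inl k # t)"
      have kt: "Inl k # t \<in> templates ?K m (Suc b)" using t(1) by (auto simp: templates_def)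
      then have l: "l \<in> templates ?K m M" unfolding l_def by (rule tinst_in_templates[OF U'])
      show ?thesis
      proof (rule bexI)
        show "map Inl u @ l @ map Inl y \<in> templates ?K m n"
          using prefix_in_templates[OF u(2) suffix_in_templates[of y ?K q l m M]] l y u(1)
          by (simp add: Y_def add.assoc)
        show "(d + \<gamma>) * real ?K ^ m \<le> card {w\<in>words ?K m. inst (map Inl u @ l @ map Inl y) w \<in> A}"
          using t(2) inst_tinst[OF U' length_template[OF kt]] by (simp add: l_def B_def C_def)
      qed
    qed
    then show ?thesis by blast
  qed
  then show ?thesis using \<gamma>(1) by blast
qed

text \<open>Induction on the alphabet. As \<gamma> is fixed by the initial density, without a line
  the density would exceed 1 after boundedly many increments.\<close>

theorem density_Hales_Jewett:
  assumes "0 < k" "0 < d"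
  shows "\<exists>n. DHJ k d n"
  using assms
proof (induction k arbitrary: d rule: nat_induct_non_zero)
  case 1
  have "has_line 1 1 A" if "A \<subseteq> words 1 1" "d * real 1 ^ 1 \<le> card A" for A
  proof -
    have "words 1 1 = {[0]}" by (auto simp: words_def length_Suc_conv)
    moreover have "A \<noteq> {}" using that(2) 1 by auto
    ultimately have "[0] \<in> A" using that(1) by auto
    then show ?thesis unfolding has_line_def by (intro bexI[of _ "[Inr 0]"]) (auto simp: templates_def)
  qed
  then show ?case unfolding DHJ_def by blast
next
  case (Suc k)
  have "\<exists>\<gamma>>0::real. \<forall>d'\<ge>d. \<forall>m.
    \<exists>n. \<forall>A\<subseteq>words (Suc k) n. d' * real (Suc k) ^ n \<le> card A \<longrightarrow>
      has_line (Suc k) n A \<or>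
      (\<exists>t\<in>templates (Suc k) m n. (d' + \<gamma>) * real (Suc k) ^ m \<le> card {w\<in>words (Suc k) m. inst t w \<in> A})"
    by (rule density_increment[OF _ Suc.hyps Suc.prems]) (rule Suc.IH)
  then obtain \<gamma> :: real where \<gamma>: "0 < \<gamma>" "\<forall>d'\<ge>d. \<forall>m.
    \<exists>n. \<forall>A\<subseteq>words (Suc k) n. d' * real (Suc k) ^ n \<le> card A \<longrightarrow>
      has_line (Suc k) n A \<or>
      (\<exists>t\<in>templates (Suc k) m n. (d' + \<gamma>) * real (Suc k) ^ m \<le> card {w\<in>words (Suc k) m. inst t w \<in> A})"
    by (elim exE conjE)
  have *: "\<exists>n. DHJ (Suc k) d' n" if "d \<le> d'" "1 < d' + j * \<gamma>" for d' and j :: nat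
    using that
  proof (induction j arbitrary: d')
    case 0
    have "\<not> d' \<le> real (card A)" if "A \<subseteq> words (Suc k) 0" for A
      using card_mono[OF finite_words that] 0 by simp
    then show ?case by (intro exI[of _ 0]) (simp add: DHJ_def)
  next
    case (Suc j)
    have "\<exists>m. DHJ (Suc k) (d' + \<gamma>) m"
      using Suc.prems \<gamma>(1) by (intro Suc.IH) (auto simp: algebra_simps)
    then obtain m where m: "DHJ (Suc k) (d' + \<gamma>) m" by blast
    obtain n where n: "\<And>A. \<lbrakk>A\<subseteq>words (Suc k) n; d' * real (Suc k) ^ n \<le> card A\<rbrakk> \<Longrightarrow>
      has_line (Suc k) n A \<or>
      (\<exists>t\<in>templates (Suc k) m n. (d' + \<gamma>) * real (Suc k) ^ m \<le> card {w\<in>words (Suc k) m. inst t w \<in> A})"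
      using \<gamma>(2)[rule_format, OF Suc.prems(1)] by blast
    have "has_line (Suc k) n A" if "A\<subseteq>words (Suc k) n" "d' * real (Suc k) ^ n \<le> card A" for A
      using n[OF that]
    proof
      assume "\<exists>t\<in>templates (Suc k) m n. (d' + \<gamma>) * real (Suc k) ^ m \<le> card {w\<in>words (Suc k) m. inst t w \<in> A}"
      then obtain t where t: "t\<in>templates (Suc k) m n"
        "(d' + \<gamma>) * real (Suc k) ^ m \<le> card {w\<in>words (Suc k) m. inst t w \<in> A}" by blast
      then have "has_line (Suc k) m {w\<in>words (Suc k) m. inst t w \<in> A}"
        by (intro m[unfolded DHJ_def, rule_format]) auto
      then have "has_line (Suc k) m {w. inst t w \<in> A}" unfolding has_line_def by blast
      then show ?thesis by (rule has_line_inst[OF t(1)])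
    qed
    then show ?case unfolding DHJ_def by blast
  qed
  obtain j :: nat where "(1 - d) / \<gamma> < j" using reals_Archimedean2 by blast
  then have "1 < d + j * \<gamma>" using \<gamma>(1) by (simp add: field_simps)
  then show ?case by (rule *[OF order_refl])
qed

section \<open>Rich sets and invariant means\<close>

lemma ssum_cong:
  assumes "finite \<alpha>" "\<alpha> \<noteq> {}" "\<And>i. i \<in> \<alpha> \<Longrightarrow> f i = g i"
  shows "ssum f \<alpha> = ssum g \<alpha>"
  using assms by (induction rule: finite_ne_induct) (simp_all add: ssum_insert)

lemma ssum_Un:
  assumes "finite \<alpha>" "\<alpha> \<noteq> {}" "finite \<beta>" "\<beta> \<noteq> {}" "\<alpha> \<inter> \<beta> = {}"
  shows "ssum f (\<alpha> \<union> \<beta>) = ssum f \<alpha> + ssum f \<beta>"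
  using assms by (induction rule: finite_ne_induct) (simp_all add: ssum_insert add.assoc)

lemma ssum_UN:
  assumes "finite \<alpha>" "\<alpha> \<noteq> {}" "\<And>i. i \<in> \<alpha> \<Longrightarrow> finite (I i) \<and> I i \<noteq> {}"
    and "\<And>i j. i \<in> \<alpha> \<Longrightarrow> j \<in> \<alpha> \<Longrightarrow> i \<noteq> j \<Longrightarrow> I i \<inter> I j = {}"
  shows "ssum f (\<Union>i\<in>\<alpha>. I i) = ssum (\<lambda>i. ssum f (I i)) \<alpha>"
  using assms
proof (induction rule: finite_ne_induct)
  case (singleton i)
  then show ?case by simp
next
  case (insert i \<alpha>)
  have "I i \<inter> (\<Union>i\<in>\<alpha>. I i) = {}" using insert.prems(2)[of i] insert.hyps by blast
  moreover have "(\<Union>i\<in>\<alpha>. I i) \<noteq> {}" using insert.prems(1) insert.hyps by blast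
  ultimately have "ssum f (I i \<union> (\<Union>i\<in>\<alpha>. I i)) = ssum f (I i) + ssum f (\<Union>i\<in>\<alpha>. I i)"
    using insert.prems(1) insert.hyps by (intro ssum_Un) auto
  also have "ssum f (\<Union>i\<in>\<alpha>. I i) = ssum (\<lambda>i. ssum f (I i)) \<alpha>"
    using insert.prems by (intro insert.IH) auto
  finally show ?case using insert.hyps by (simp add: ssum_insert)
qed

section \<open>Elementary properties of means\<close>

context
  fixes T :: "'a set" and m
  assumes mean: "mean_on T m"
begin

lemma mean_add: "bounded (f ` T) \<Longrightarrow> bounded (g ` T) \<Longrightarrow> m (\<lambda>x. f x + g x) = m f + m g"
  and mean_scale: "bounded (f ` T) \<Longrightarrow> m (\<lambda>x. c * f x) = c * m f"
  and mean_nonneg: "bounded (f ` T) \<Longrightarrow> (\<And>x. x \<in> T \<Longrightarrow> 0 \<le> f x) \<Longrightarrow> 0 \<le> m f"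
  using mean unfolding mean_on_def by blast+

lemma mean_mono:
  assumes "bounded (f ` T)" "bounded (g ` T)" "\<And>x. x \<in> T \<Longrightarrow> f x \<le> g x"
  shows "m f \<le> m g"
proof -
  have neg: "bounded ((\<lambda>x. - 1 * f x) ` T)"
    using bounded_scaling[OF assms(1), of "- 1"] by (simp add: image_image)
  have "m (\<lambda>x. g x + - 1 * f x) = m g + m (\<lambda>x. - 1 * f x)"
    by (rule mean_add[OF assms(2) neg])
  moreover have "0 \<le> m (\<lambda>x. g x + - 1 * f x)"
    using assms(3) by (intro mean_nonneg bounded_plus_comp[OF assms(2) neg]) auto
  ultimately show ?thesis using mean_scale[OF assms(1), of "- 1"] by linarith
qed

text \<open>The constant function lies in the unit ball over which the norm is a supremum. The
  supremum dominates its value because all values are bounded by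
  \<open>m (\<lambda>_. 1)\<close>.\<close>

lemma mean_one_le: "m (\<lambda>_. 1) \<le> 1"
proof -
  have bdd: "bounded (f ` T)" if "\<forall>x\<in>T. \<bar>f x\<bar> \<le> 1" for f :: "'a \<Rightarrow> real"
    using that by (auto simp: bounded_iff)
  have "\<bar>m f\<bar> \<le> m (\<lambda>_. 1)" if f: "\<forall>x\<in>T. \<bar>f x\<bar> \<le> 1" for f
  proof -
    have "m f \<le> m (\<lambda>_. 1)" using f by (intro mean_mono bdd) (auto simp: abs_le_iff)
    moreover have "m (\<lambda>x. - 1 * f x) \<le> m (\<lambda>_. 1)" using f by (intro mean_mono bdd) (auto simp: abs_le_iff)
    ultimately show ?thesis using mean_scale[OF bdd[OF f], of "- 1"] by linarith
  qed
  then have "bdd_above ((\<lambda>f. \<bar>m f\<bar>) ` {f. \<forall>x\<in>T. \<bar>f x\<bar> \<le> 1})" by (intro bdd_aboveI2[where M = "m (\<lambda>_. 1)"]) simp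
  then have "\<bar>m (\<lambda>_. 1)\<bar> \<le> (SUP f\<in>{f. \<forall>x\<in>T. \<bar>f x\<bar> \<le> 1}. \<bar>m f\<bar>)"
    by (intro cSUP_upper) auto
  then show ?thesis using mean unfolding mean_on_def by linarith
qed

lemma mean_sum:
  assumes "finite W" "\<And>w. w \<in> W \<Longrightarrow> bounded (f w ` T)"
  shows "bounded ((\<lambda>x. \<Sum>w\<in>W. f w x) ` T) \<and> m (\<lambda>x. \<Sum>w\<in>W. f w x) = (\<Sum>w\<in>W. m (f w))"
  using assms
proof (induction W rule: finite_induct)
  case empty
  have "bounded ((\<lambda>_. 0::real) ` T)" by (auto simp: bounded_iff)
  then show ?case using mean_scale[of "\<lambda>_. 0" 0] by simp
next
  case (insert w W)
  then show ?case by (simp add: mean_add bounded_plus_comp)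
qed

end

text \<open>By invariance the sum over \<open>w\<close> of the translated indicators has mean
  \<open>card W * m (indicator A)\<close>. Were it at most half of this on all of \<open>R\<close>,
  so would be its mean.\<close>

lemma popular_translate:
  assumes "left_invariant_mean_on R m" "finite W" "W \<noteq> {}" "\<And>w. w \<in> W \<Longrightarrow> t w \<in> R"
    and pos: "0 < m (indicator A)"
  shows "\<exists>x\<in>R. m (indicator A) / 2 * card W \<le> card {w\<in>W. t w * x \<in> A}"
proof (rule ccontr)
  let ?e = "m (indicator A)"
  assume "\<not> ?thesis"
  then have few: "card {w\<in>W. t w * x \<in> A} \<le> ?e / 2 * card W" if "x \<in> R" for x
    using that by auto
  have mean: "mean_on R m" using assms(1) by (simp add: left_invariant_mean_on_def)
  have bdd: "bounded (g ` R)" if "\<And>x. x \<in> R \<Longrightarrow> \<bar>g x\<bar> \<le> c" for g :: "'a \<Rightarrow> real" and c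
    using that by (auto simp: bounded_iff)
  have ind: "bounded ((\<lambda>x. indicator A (h x) :: real) ` R)" for h
    by (rule bdd[of _ 1]) (auto simp: indicator_def)
  have inv: "m (\<lambda>x. indicator A (t w * x)) = ?e" if "w \<in> W" for w
    using assms(1) assms(4)[OF that] ind[of "\<lambda>x. x"] unfolding left_invariant_mean_on_def by blast
  have sum: "bounded ((\<lambda>x. \<Sum>w\<in>W. indicator A (t w * x) :: real) ` R)"
    "m (\<lambda>x. \<Sum>w\<in>W. indicator A (t w * x)) = ?e * card W"
    using mean_sum[OF mean assms(2), of "\<lambda>w x. indicator A (t w * x)"] ind inv by simp_all
  have "m (\<lambda>x. \<Sum>w\<in>W. indicator A (t w * x)) \<le> m (\<lambda>_. ?e / 2 * card W * 1)"
  proof (rule mean_mono[OF mean sum(1)])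
    show "bounded ((\<lambda>_. ?e / 2 * card W * 1) ` R)" by (rule bdd) (rule order_refl)
    show "(\<Sum>w\<in>W. indicator A (t w * x)) \<le> ?e / 2 * card W * 1" if "x \<in> R" for x
      using few[OF that] assms(2) by (simp add: indicator_def sum.If_cases Int_def)
  qed
  also have "\<dots> = ?e / 2 * card W * m (\<lambda>_. 1)"
    by (rule mean_scale[OF mean]) (auto simp: bounded_iff)
  also have "\<dots> \<le> ?e / 2 * card W * 1"
    using pos by (intro mult_left_mono mean_one_le[OF mean]) auto
  finally show False using sum(2) pos assms(2,3) by (simp add: card_gt_0_iff)
qed

theorem theorem8p2:
  fixes R A :: "'a::semiring set"
  assumes subsemigroup: "\<And>x y. x \<in> R \<Longrightarrow> y \<in> R \<Longrightarrow> x * y \<in> R"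
    and amenable: "left_amenable R"
    and rich: "combinatorially_rich R"
    and subset: "A \<subseteq> R"
    and density: "upper_banach_density R A > 0"
  shows "combinatorially_rich_upto {right_mult r | r. r \<in> R} A"
  unfolding combinatorially_rich_upto_def
proof (intro allI impI)
  fix n :: nat assume "1 \<le> n"
  then have n: "0 < n" by simp
  \<comment> \<open>Left amenability makes the set of means nonempty, so a positive supremum
    requires a positive value.\<close>
  obtain m where m: "left_invariant_mean_on R m" "0 < m (indicator A)"
  proof (rule ccontr)
    assume "\<not> thesis"
    then have "m (indicator A) \<le> 0" if "left_invariant_mean_on R m" for m
      using that \<open>\<And>m. \<lbrakk>left_invariant_mean_on R m; 0 < m (indicator A)\<rbrakk> \<Longrightarrow> thesis\<close> not_le by blast
    then have "upper_banach_density R A \<le> 0"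
      using amenable unfolding upper_banach_density_def left_amenable_def
      by (intro cSUP_least) auto
    then show False using density by simp
  qed
  define e where "e = m (indicator A) / 2"
  obtain d where d: "DHJ n e d" using density_Hales_Jewett[OF n, of e] m(2) by (auto simp: e_def)
  let ?W = "words n d"
  have W: "?W \<noteq> {}" using words_nonempty[OF n] .
  \<comment> \<open>Richness is applied to matrices with one column for each word; \<open>h\<close>
    numbers the columns from 1.\<close>
  obtain h where h: "bij_betw h {1..card ?W} ?W"
    using ex_bij_betw_nat_finite_1[OF finite_words] by blast
  have "1 \<le> card ?W" using n by (simp add: Suc_le_eq)
  from rich[unfolded combinatorially_rich_def, rule_format, OF this]
  obtain r where r: "1 \<le> r" "\<forall>M :: nat \<Rightarrow> nat \<Rightarrow> 'a. \<exists>\<alpha> s. \<alpha> \<noteq> {} \<and> \<alpha> \<subseteq> {1..r} \<and>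
      (\<forall>j\<in>{1..card ?W}. s + ssum (\<lambda>i. M i j) \<alpha> \<in> R)"
    by (elim exE conjE)
  define I where "I i = {(i - 1) * d + 1..i * d}" for i
  \<comment> \<open>\<open>0 < d\<close> comes out of the combinatorial line, which has a wildcard;
    it makes \<open>r * d\<close> at least 1.\<close>
  have main: "0 < d \<and> (\<exists>\<alpha> \<psi> s. \<alpha> \<noteq> {} \<and> \<alpha> \<subseteq> {1..r * d} \<and> \<psi> \<in> {right_mult r |r. r \<in> R} \<and>
    (\<forall>j\<in>{1..n}. s + \<psi> (ssum (\<lambda>i. M i j) \<alpha>) \<in> A))" for M :: "nat \<Rightarrow> nat \<Rightarrow> 'a"
  proof -
    \<comment> \<open>Row \<rho> has place \<open>(\<rho> - 1) mod d\<close> in its block. Letters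
      start at 0 and columns at 1, hence \<open>Suc\<close>.\<close>
    define F where "F w \<rho> = M \<rho> (Suc (w ! ((\<rho> - 1) mod d)))" for w \<rho>
    obtain \<alpha> s where \<alpha>: "\<alpha> \<noteq> {}" "\<alpha> \<subseteq> {1..r}"
      "\<And>j. j\<in>{1..card ?W} \<Longrightarrow> s + ssum (\<lambda>i. ssum (F (h j)) (I i)) \<alpha> \<in> R"
      using r(2)[rule_format, of "\<lambda>i j. ssum (F (h j)) (I i)"] by blast
    define t where "t w = s + ssum (\<lambda>i. ssum (F w) (I i)) \<alpha>" for w
    have "t w \<in> R" if "w \<in> ?W" for w
    proof -
      have "w \<in> h ` {1..card ?W}" using h that by (simp only: bij_betw_imp_surj_on)
      then obtain j where "j \<in> {1..card ?W}" "w = h j" by blast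
      then show ?thesis using \<alpha>(3)[of j] by (simp add: t_def)
    qed
    then obtain x where x: "x \<in> R" "e * card ?W \<le> card {w\<in>?W. t w * x \<in> A}"
      using popular_translate[OF m(1) finite_words W _ m(2)] unfolding e_def by blast
    then have "has_line n d {w\<in>?W. t w * x \<in> A}"
      by (intro d[unfolded DHJ_def, rule_format]) auto
    then obtain l where l: "l \<in> templates n 1 d" "\<And>c. c < n \<Longrightarrow> t (inst l [c]) * x \<in> A"
      unfolding has_line_def by blast
    have "Inr 0 \<in> set l" using l(1) by (auto simp: templates_def)
    then obtain p where p: "p < d" "l ! p = Inr 0"
      using l(1) by (auto simp: in_set_conv_nth templates_def)
    have d0: "0 < d" using p by simp
    have fin\<alpha>: "finite \<alpha>" using \<alpha>(2) finite_subset by blast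
    define J where "J = (\<Union>i\<in>\<alpha>. I i)"
    define \<alpha>' where "\<alpha>' = {\<rho>\<in>J. l ! ((\<rho> - 1) mod d) = Inr 0}"
    define \<beta> where "\<beta> = J - \<alpha>'"
    have J: "J \<subseteq> {1..r * d}"
    proof
      fix \<rho> assume "\<rho> \<in> J"
      then obtain i where i: "i \<in> \<alpha>" "\<rho> \<in> I i" by (auto simp: J_def)
      then have "i * d \<le> r * d" using \<alpha>(2) by (intro mult_le_mono1) auto
      moreover have "1 \<le> \<rho>" "\<rho> \<le> i * d" using i(2) by (auto simp: I_def)
      ultimately show "\<rho> \<in> {1..r * d}" using order_trans[of \<rho> "i * d" "r * d"] by (simp del: mult_le_cancel2)
    qed
    have finJ: "finite J" using J finite_subset by blast
    have fin: "finite \<alpha>'" "finite \<beta>" using finJ by (auto simp: \<alpha>'_def \<beta>_def)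
    have "\<alpha>' \<noteq> {}"
    proof -
      obtain i where i: "i \<in> \<alpha>" using \<alpha>(1) by blast
      then have "1 \<le> i" using \<alpha>(2) by auto
      then have "i * d = (i - 1) * d + d" by (cases i) auto
      then have "(i - 1) * d + 1 + p \<in> \<alpha>'"
        using i p by (auto simp: \<alpha>'_def J_def I_def intro!: bexI[of _ i])
      then show ?thesis by blast
    qed
    have ssum_J: "t w = s + ssum (F w) J" for w
      unfolding t_def J_def
    proof (subst ssum_UN[OF fin\<alpha> \<alpha>(1)])
      fix i assume "i \<in> \<alpha>"
      then have "1 \<le> i" using \<alpha>(2) by auto
      then show "finite (I i) \<and> I i \<noteq> {}" using d0 by (cases i) (auto simp: I_def)
    next
      fix i j assume ij: "i \<in> \<alpha>" "j \<in> \<alpha>" "i \<noteq> j"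
      have *: "I i \<inter> I j = {}" if "i < j" for i j
      proof -
        have le: "i * d \<le> (j - 1) * d" using that by (intro mult_right_mono) auto
        have "\<rho> \<notin> I j" if "\<rho> \<in> I i" for \<rho>
        proof -
          have "\<rho> \<le> i * d" using that by (simp add: I_def)
          with le have "\<not> (j - 1) * d < \<rho>" by linarith
          then show ?thesis by (simp add: I_def)
        qed
        then show ?thesis by blast
      qed
      show "I i \<inter> I j = {}" using *[of i j] *[of j i] ij(3) by (cases "i < j") auto
    qed simp
    have J_split: "J = \<beta> \<union> \<alpha>'" "\<beta> \<inter> \<alpha>' = {}" by (auto simp: \<alpha>'_def \<beta>_def)
    have nth: "inst l [c] ! ((\<rho> - 1) mod d) = case_sum id (\<lambda>j. [c] ! j) (l ! ((\<rho> - 1) mod d))" for c \<rho>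
      using d0 length_template[OF l(1)] by (simp add: inst_def)
    \<comment> \<open>On \<beta> the template holds a fixed letter; the value of
      \<open>case_sum id id\<close> on a variable is only a default.\<close>
    define g where "g \<rho> = M \<rho> (Suc (case_sum id id (l ! ((\<rho> - 1) mod d))))" for \<rho>
    have F_wild: "F (inst l [c]) \<rho> = M \<rho> (Suc c)" if "\<rho> \<in> \<alpha>'" for c \<rho>
      using that by (simp add: F_def nth \<alpha>'_def del: One_nat_def)
    have F_const: "F (inst l [c]) \<rho> = g \<rho>" if "\<rho> \<in> \<beta>" for c \<rho>
    proof -
      have "l ! ((\<rho> - 1) mod d) \<in> set l" using d0 length_template[OF l(1)] by simp
      then have "l ! ((\<rho> - 1) mod d) \<in> Inl ` {..<n} \<union> Inr ` {..<1}"
        using l(1) by (auto simp: templates_def)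
      then show ?thesis using that by (auto simp: F_def nth g_def \<alpha>'_def \<beta>_def simp del: One_nat_def)
    qed
    \<comment> \<open>\<open>ssum\<close> has no meaningful value on the empty set, so the case that
      every row is wild is separated. Distributing the factor \<open>x\<close> moves the constant
      part into \<open>s'\<close> and leaves \<open>right_mult x\<close> of the wild part.\<close>
    define s' where "s' = (if \<beta> = {} then s else s + ssum g \<beta>) * x"
    have "s' + right_mult x (ssum (\<lambda>i. M i j) \<alpha>') \<in> A" if "j \<in> {1..n}" for j
    proof -
      have j: "j - 1 < n" "Suc (j - 1) = j" using that by auto
      have wild: "ssum (F (inst l [j - 1])) \<alpha>' = ssum (\<lambda>i. M i j) \<alpha>'"
        using F_wild j(2) by (intro ssum_cong fin \<open>\<alpha>' \<noteq> {}\<close>) simp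
      have "t (inst l [j - 1]) * x = s' + right_mult x (ssum (\<lambda>i. M i j) \<alpha>')"
      proof (cases "\<beta> = {}")
        case True
        then show ?thesis using J_split wild by (simp add: ssum_J s'_def right_mult_def distrib_right)
      next
        case False
        have "ssum (F (inst l [j - 1])) J = ssum (F (inst l [j - 1])) \<beta> + ssum (F (inst l [j - 1])) \<alpha>'"
          unfolding J_split(1) using fin \<open>\<alpha>' \<noteq> {}\<close> False J_split(2) by (intro ssum_Un)
        also have "ssum (F (inst l [j - 1])) \<beta> = ssum g \<beta>"
          using F_const by (intro ssum_cong fin False) simp
        finally show ?thesis using False wild
          by (simp add: ssum_J s'_def right_mult_def distrib_right add.assoc)
      qed
      then show ?thesis using l(2)[OF j(1)] by simp
    qed
    moreover have "\<alpha>' \<subseteq> {1..r * d}" using J by (auto simp: \<alpha>'_def)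
    ultimately show ?thesis using \<open>\<alpha>' \<noteq> {}\<close> d0 x(1) by blast
  qed
  then have "1 \<le> r * d" using r(1) by (simp add: Suc_le_eq)
  then show "\<exists>r\<ge>1. \<forall>M :: nat \<Rightarrow> nat \<Rightarrow> 'a. \<exists>\<alpha> \<psi> s. \<alpha> \<noteq> {} \<and> \<alpha> \<subseteq> {1..r} \<and>
      \<psi> \<in> {right_mult r |r. r \<in> R} \<and> (\<forall>j\<in>{1..n}. s + \<psi> (ssum (\<lambda>i. M i j) \<alpha>) \<in> A)"
    using main by blast
qed

end
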